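(* For an odd prime $p$ and positive integers $t,s$, put $r=p^t$, $q=r^s$, $T=q+1$, let $\eta$ be the quadratic multiplicative character of $\mathbb{F}_r$ (with $\eta(0)=0$), $D=\{x\in\mathbb{F}_{q^2}:\eta(\mathrm{Tr}_{q/r}(x^T))=-1\}$, $K=\#D=\frac{q(q+1)(r-1)}{2r}$, $N=q^2$, and consider the codebook $\mathcal{C}=\{\mathbf{c}_a=\frac{1}{\sqrt K}(\zeta_p^{\mathrm{Tr}_{q^2/p}(ax)})_{x\in D}: a\in\mathbb{F}_{q^2}\}$ with $\zeta_p=e^{2\pi i/p}$. Let $I_{max}(\mathcal{C})=\max_{a\neq a'}|\mathbf{c}_a\mathbf{c}_{a'}^H|$ and let $I_W=\sqrt{\frac{N-K}{(N-1)K}}$ be the Welch bound. Then $\frac{I_{max}(\mathcal{C})}{I_W}\to1$ as $r\to\infty$; that is, for every sequence of such parameter triples $(p,t,s)$ with $r=p^t\to\infty$, the ratio tends to $1$.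
   Context: $\mathrm{Tr}_{q/r}$ is the trace from $\mathbb{F}_q$ to $\mathbb{F}_r$, $\mathrm{Tr}_{q^2/p}$ the absolute trace of $\mathbb{F}_{q^2}$; $\mathbf{c}^H$ is the conjugate transpose. *)

theory Defs
  imports "HOL-Analysis.Analysis" "HOL-Algebra.Algebra"
begin

text \<open>Throughout, R is a finite field of order q^2 = p^(2ts), r = p^t, q = r^s.\<close>

definition subfield_pow :: "('a, 'm) ring_scheme \<Rightarrow> nat \<Rightarrow> 'a set" where
  "subfield_pow R m = {x \<in> carrier R. x [^]\<^bsub>R\<^esub> m = x}"

definition rel_trace :: "('a, 'm) ring_scheme \<Rightarrow> nat \<Rightarrow> nat \<Rightarrow> 'a \<Rightarrow> 'a" where
  "rel_trace R r s y = finsum R (\<lambda>i. y [^]\<^bsub>R\<^esub> (r ^ i)) {..<s}"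

definition quad_char :: "('a, 'm) ring_scheme \<Rightarrow> nat \<Rightarrow> 'a \<Rightarrow> int" where
  "quad_char R r y =
     (if y = \<zero>\<^bsub>R\<^esub> then 0
      else if \<exists>z \<in> subfield_pow R r. z \<otimes>\<^bsub>R\<^esub> z = y then 1 else -1)"

definition defset :: "('a, 'm) ring_scheme \<Rightarrow> nat \<Rightarrow> nat \<Rightarrow> nat \<Rightarrow> 'a set" where
  "defset R p t s = {x \<in> carrier R.
      quad_char R (p ^ t) (rel_trace R (p ^ t) s (x [^]\<^bsub>R\<^esub> ((p ^ t) ^ s + 1))) = -1}"

definition abs_trace :: "('a, 'm) ring_scheme \<Rightarrow> nat \<Rightarrow> nat \<Rightarrow> 'a \<Rightarrow> 'a" where
  "abs_trace R p m x = finsum R (\<lambda>i. x [^]\<^bsub>R\<^esub> (p ^ i)) {..<m}"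

definition prime_field_rep :: "('a, 'm) ring_scheme \<Rightarrow> nat \<Rightarrow> 'a \<Rightarrow> nat" where
  "prime_field_rep R p y = (THE k. k < p \<and> add_pow R k \<one>\<^bsub>R\<^esub> = y)"

definition add_char :: "('a, 'm) ring_scheme \<Rightarrow> nat \<Rightarrow> nat \<Rightarrow> 'a \<Rightarrow> complex" where
  "add_char R p m x = exp (2 * pi * \<i> / of_nat p) ^ prime_field_rep R p (abs_trace R p m x)"

definition codebook_corr :: "('a, 'm) ring_scheme \<Rightarrow> nat \<Rightarrow> nat \<Rightarrow> nat \<Rightarrow> 'a \<Rightarrow> 'a \<Rightarrow> complex" where
  "codebook_corr R p t s a a' =
     (let D = defset R p t s; K = card D in
      (\<Sum>x\<in>D. (add_char R p (2 * t * s) (mult R a x) / of_real (sqrt (real K)))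
             * cnj (add_char R p (2 * t * s) (mult R a' x) / of_real (sqrt (real K)))))"

definition Imax :: "('a, 'm) ring_scheme \<Rightarrow> nat \<Rightarrow> nat \<Rightarrow> nat \<Rightarrow> real" where
  "Imax R p t s = Max {cmod (codebook_corr R p t s a a') | a a'.
       a \<in> carrier R \<and> a' \<in> carrier R \<and> a \<noteq> a'}"

definition welch_bound :: "nat \<Rightarrow> nat \<Rightarrow> real" where
  "welch_bound N K = sqrt ((real N - real K) / ((real N - 1) * real K))"

end

(*
The additive characters of the subfields evaluate everything. For u in F_r, u <> 0, completing the
norm in u N(x) - Tr(a x) shows that the sum over x of psi_r(-u Q(x)) chi(a x), with
Q(x) = Tr_{q/r}(x^(q+1)), equals -q psi_r(Q(a)/u), because each nonzero element of F_q is the norm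
of exactly q + 1 elements. Expanding the indicator of Q(x) = c, c a nonsquare, in characters of
F_r expresses the character sum S(a) over D through the periods of the nonsquares. At
nonzero arguments they take only two values alpha, beta; orthogonality gives alpha + beta = -1 and
|alpha|^2 + |beta|^2 = (r + 1)/2, whence r |S(a)| <= q (r + 1)/2 for a <> 0 without evaluating a
Gauss sum. Together with the value of K = S(0) this bounds I_max from above by (1 + 2/(r - 1)) I_W,
while Parseval gives I_max >= I_W.
*)
theory Submission
  imports Defs "HOL-Real_Asymp.Real_Asymp"
begin

(* [k] \<cdot> x could also be read as an ideal product. *)
no_notation ideal_prod (infixl \<open>\<cdot>\<index>\<close> 80)

text \<open>The step from the two period identities to the bound is a short case check. With h = (r
  - 1)/2, the sum over u <> 0 of period(u) psi_r(c/u) equals -h for c = 0, 2 alpha beta for c a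
  nonzero square, and alpha^2 + beta^2 for c a nonsquare; each has absolute value at most |alpha|^2
  + |beta|^2 = h + 1. After division by K this gives I_max <= (h + 1)/((q + 1) h), while 1/(q + 1)
  <= I_W; hence the factor (h + 1)/h = 1 + 2/(r - 1). It depends on r alone, so s may vary freely
  along the sequence. F_r and F_q are realised inside R as fixed sets of Frobenius powers, and the
  characters of F_r, F_q and R are one function \<open>add_char R p m\<close> with m = t, t * s and
  2 * t * s. Orthogonality needs these characters to be nontrivial, that is, the trace must not
  vanish identically on the subfield; this is obtained from power sums.\<close>

context cring
begin

section \<open>The binomial theorem and the Frobenius map in a commutative ring\<close>

lemma add_pow_add:
  "x \<in> carrier R \<Longrightarrow> [(m + n :: nat)] \<cdot> x = [m] \<cdot> x \<oplus> [n] \<cdot> x"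
  using add.nat_pow_mult[of x m n] by simp

lemma binomial_expansion:
  assumes x: "x \<in> carrier R" and y: "y \<in> carrier R"
  shows "(x \<oplus> y) [^] (n::nat) =
    (\<Oplus>k\<in>{..n}. [(n choose k)] \<cdot> (x [^] k \<otimes> y [^] (n - k)))"
proof (induction n)
  case 0
  then show ?case using x y by simp
next
  case (Suc n)
  let ?b = "\<lambda>n k. [(n choose k)] \<cdot> (x [^] k \<otimes> y [^] (n - k))"
  let ?c = "\<lambda>k. [(n choose Suc k)] \<cdot> (x [^] Suc k \<otimes> y [^] (n - k))"
  have b[simp]: "?b m k \<in> carrier R" for m k using x y by simp
  have c[simp]: "?c k \<in> carrier R" for k using x y by (simp del: nat_pow_Suc)
  have step: "?b (Suc n) (Suc k) = x \<otimes> ?b n k \<oplus> ?c k" for k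
  proof -
    have "x \<otimes> ?b n k = [(n choose k)] \<cdot> (x [^] Suc k \<otimes> y [^] (n - k))"
      using x y by (simp add: add_pow_rdistr m_ac)
    then show ?thesis using x y by (simp add: add_pow_add del: nat_pow_Suc)
  qed
  \<comment> \<open>Multiplying the expansion by y leaves the powers of x alone. Reindexing by one
    splits off the term y^(n+1), and the extra top term vanishes because n choose (n + 1) is
    0.\<close>
  have shift: "(\<Oplus>k\<in>{..n}. ?c k) \<oplus> y [^] Suc n = (\<Oplus>k\<in>{..n}. ?b n k) \<otimes> y"
  proof -
    let ?d = "\<lambda>k. [(n choose k)] \<cdot> (x [^] k \<otimes> y [^] (Suc n - k))"
    have d: "?d k \<in> carrier R" for k using x y by (simp del: nat_pow_Suc)
    have "(\<Oplus>k\<in>{..n}. ?c k) \<oplus> y [^] Suc n = (\<Oplus>k\<in>{..Suc n}. ?d k)"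
      using finsum_Suc2[of ?d n] x y d by (simp del: nat_pow_Suc)
    also have "\<dots> = (\<Oplus>k\<in>{..n}. ?d k)"
      using finsum_Suc[of ?d n] d finsum_closed[of ?d "{..n}"] x
      by (simp add: binomial_eq_0 del: nat_pow_Suc add.finprod_closed)
    also have "\<dots> = (\<Oplus>k\<in>{..n}. ?b n k \<otimes> y)"
      using x y by (intro finsum_cong') (auto simp: add_pow_ldistr m_assoc Suc_diff_le)
    also have "\<dots> = (\<Oplus>k\<in>{..n}. ?b n k) \<otimes> y"
      using finsum_ldistr[of "{..n}" y "?b n"] y by simp
    finally show ?thesis .
  qed
  have "(\<Oplus>k\<in>{..Suc n}. ?b (Suc n) k) = (\<Oplus>k\<in>{..n}. ?b (Suc n) (Suc k)) \<oplus> y [^] Suc n"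
    using finsum_Suc2[of "?b (Suc n)" n] x y by (simp del: nat_pow_Suc)
  also have "(\<Oplus>k\<in>{..n}. ?b (Suc n) (Suc k)) = (\<Oplus>k\<in>{..n}. x \<otimes> ?b n k \<oplus> ?c k)"
    using x c by (intro finsum_cong' step refl) auto
  also have "\<dots> = (\<Oplus>k\<in>{..n}. x \<otimes> ?b n k) \<oplus> (\<Oplus>k\<in>{..n}. ?c k)"
    using x c by (intro finsum_addf) auto
  also have "(\<Oplus>k\<in>{..n}. x \<otimes> ?b n k) = x \<otimes> (\<Oplus>k\<in>{..n}. ?b n k)"
    using finsum_rdistr[of "{..n}" x "?b n"] x by simp
  finally have "(\<Oplus>k\<in>{..Suc n}. ?b (Suc n) k)
      = (x \<otimes> (\<Oplus>k\<in>{..n}. ?b n k) \<oplus> (\<Oplus>k\<in>{..n}. ?c k)) \<oplus> y [^] Suc n" .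
  also have "\<dots> = x \<otimes> (\<Oplus>k\<in>{..n}. ?b n k) \<oplus> ((\<Oplus>k\<in>{..n}. ?c k) \<oplus> y [^] Suc n)"
    using x y c by (intro a_assoc) (auto intro!: finsum_closed simp del: nat_pow_Suc)
  also have "\<dots> = (x \<oplus> y) [^] n \<otimes> (x \<oplus> y)"
    unfolding shift Suc.IH[symmetric] using x y by (simp add: l_distr r_distr m_comm)
  finally show ?case by simp
qed

text \<open>The inner binomial coefficients are multiples of p, and these annihilate every element
  because p annihilates \<open>\<one>\<close>.\<close>

lemma freshmans_dream:
  assumes p: "Factorial_Ring.prime (p::nat)" and char: "[p] \<cdot> \<one> = \<zero>"
    and x: "x \<in> carrier R" and y: "y \<in> carrier R"
  shows "(x \<oplus> y) [^] p = x [^] p \<oplus> y [^] p"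
proof -
  let ?b = "\<lambda>k. [(p choose k)] \<cdot> (x [^] k \<otimes> y [^] (p - k))"
  have b: "?b k \<in> carrier R" for k using x y by simp
  have pz: "[p] \<cdot> z = \<zero>" if "z \<in> carrier R" for z
    using add_pow_ldistr[of \<one> z p] that char by simp
  have b0: "?b k = \<zero>" if "k \<in> {..p} - {0, p}" for k
  proof -
    have "p dvd (p choose k)" using that p by (intro dvd_choose_prime) auto
    then obtain c where c: "p choose k = p * c" ..
    have "[(p * c)] \<cdot> z = \<zero>" if "z \<in> carrier R" for z
      using add.nat_pow_pow[of z p c] add.nat_pow_pow[of z c p] pz[OF that] that
      by (simp add: mult.commute)
    then show ?thesis using c x y by simp
  qed
  have "(x \<oplus> y) [^] p = (\<Oplus>k\<in>{..p}. ?b k)" by (rule binomial_expansion[OF x y])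
  also have "\<dots> = (\<Oplus>k\<in>{0, p}. ?b k)"
    by (rule add.finprod_mono_neutral_cong_right) (use b0 b in auto)
  also have "\<dots> = x [^] p \<oplus> y [^] p"
    using prime_gt_0_nat[OF p] x y by (simp add: a_comm)
  finally show ?thesis .
qed

end

section \<open>Finite fields of order p^M and their characteristic\<close>

locale finite_field_order = field R for R (structure) +
  fixes p M :: nat
  assumes fin: "finite (carrier R)"
    and prime_p: "Factorial_Ring.prime p"
    and card_R: "card (carrier R) = p ^ M"
begin

lemma nonzero_pow_nonzero:
  "x \<in> carrier R \<Longrightarrow> x \<noteq> \<zero> \<Longrightarrow> x [^] (n::nat) \<noteq> \<zero>"
  by (induction n) (auto simp: integral_iff)

lemma M_pos: "M > 0"
proof (rule ccontr)
  assume "\<not> M > 0"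
  then have "card (carrier R) = 1" using card_R by simp
  then obtain z where "carrier R = {z}" by (rule card_1_singletonE)
  then show False using zero_closed one_closed one_not_zero by simp
qed

lemma p_ge_2: "p \<ge> 2" using prime_p by (rule prime_ge_2_nat)

text \<open>By Lagrange in the additive group p^M annihilates \<open>\<one>\<close>. That multiple
  of \<open>\<one>\<close> is the M-th power of \<open>[p] \<cdot> \<one>\<close>, and a field has
  no nonzero nilpotents.\<close>

lemma char_p: "[p] \<cdot> \<one> = \<zero>"
proof -
  have "[(p ^ M)] \<cdot> \<one> = \<zero>"
    using add.pow_order_eq_1[of \<one>] card_R by (simp add: order_def add_pow_def fin)
  moreover have "[(p ^ k)] \<cdot> \<one> = ([p] \<cdot> \<one>) [^] k" for k
  proof (induction k)
    case 0 then show ?case by (simp add: add_pow_def)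
  next
    case (Suc k)
    have "[(p ^ Suc k)] \<cdot> \<one> = [p] \<cdot> ([(p ^ k)] \<cdot> \<one>)"
      by (simp add: add.nat_pow_pow mult.commute)
    also have "\<dots> = ([(p ^ k)] \<cdot> \<one>) \<otimes> ([p] \<cdot> \<one>)"
      using add_pow_rdistr[of "[(p ^ k)] \<cdot> \<one>" \<one> p] by simp
    finally show ?case using Suc by simp
  qed
  ultimately have "([p] \<cdot> \<one>) [^] M = \<zero>" by simp
  then show ?thesis
    using nonzero_pow_nonzero[of "[p] \<cdot> \<one>" M] by auto
qed

end

lemma minus_one_dvd_power_minus_one:
  fixes a :: nat
  assumes "a > 0"
  shows "a - 1 dvd a ^ k - 1"
proof (induction k)
  case (Suc k)
  have "a ^ k > 0" using assms by simp
  then have "a ^ Suc k - 1 = a * (a ^ k - 1) + (a - 1)"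
    using assms by (simp add: diff_mult_distrib2)
  then show ?case using Suc by (simp only: dvd_add dvd_mult dvd_refl)
qed simp

context finite_field_order
begin

lemma card_gt_1: "p ^ M > 1"
  using p_ge_2 M_pos by (metis one_less_power One_nat_def Suc_1 Suc_le_lessD)

lemma pow_order_minus_one: "x \<in> carrier R \<Longrightarrow> x \<noteq> \<zero> \<Longrightarrow> x [^] (p ^ M - 1) = \<one>"
  using units_power_order_eq_one[of x] fin card_R by (simp add: field_Units)

lemma pow_order: "x \<in> carrier R \<Longrightarrow> x [^] (p ^ M) = x"
proof (cases "x = \<zero>")
  case True
  then show ?thesis using nat_pow_zero[of "p ^ M"] p_ge_2 by simp
next
  case False
  assume x: "x \<in> carrier R"
  have "x [^] (Suc (p ^ M - 1)) = x"
    using pow_order_minus_one[OF x False] x by simp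
  moreover have "Suc (p ^ M - 1) = p ^ M" using card_gt_1 by simp
  ultimately show ?thesis by (simp only:)
qed

lemma add_pow_prime_power:
  assumes x: "x \<in> carrier R" and y: "y \<in> carrier R"
  shows "(x \<oplus> y) [^] (p ^ m) = x [^] (p ^ m) \<oplus> y [^] (p ^ m)"
proof (induction m)
  case 0
  then show ?case using x y by simp
next
  case (Suc m)
  have "(x \<oplus> y) [^] (p ^ Suc m) = ((x \<oplus> y) [^] (p ^ m)) [^] p"
    using x y by (simp add: nat_pow_pow mult.commute)
  also have "\<dots> = (x [^] (p ^ m)) [^] p \<oplus> (y [^] (p ^ m)) [^] p"
    using Suc x y by (simp add: freshmans_dream[OF prime_p char_p])
  finally show ?case using x y by (simp add: nat_pow_pow mult.commute)
qed

lemma zero_pow_prime_power [simp]: "\<zero> [^] (p ^ m) = \<zero>"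
  using nat_pow_zero[of "p ^ m"] p_ge_2 by simp

lemma minus_pow_prime_power:
  assumes x: "x \<in> carrier R"
  shows "(\<ominus> x) [^] (p ^ m) = \<ominus> (x [^] (p ^ m))"
proof -
  have "x [^] (p ^ m) \<oplus> (\<ominus> x) [^] (p ^ m) = \<zero>"
    using add_pow_prime_power[of x "\<ominus> x" m] x by (simp add: r_neg)
  then show ?thesis using x by (metis a_inv_closed add.inv_equality add.m_comm nat_pow_closed)
qed

section \<open>Fibres of power maps\<close>

abbreviation roots_of_unity :: "nat \<Rightarrow> 'a set" where
  "roots_of_unity d \<equiv> {y \<in> carrier R. y [^] d = \<one>}"

text \<open>Dividing by one fixed preimage embeds the fibre into the e-th roots of unity.\<close>

lemma power_fibre_le:
  assumes e: "e > 0" and y: "y \<in> carrier R" "y \<noteq> \<zero>"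
  shows "card {x \<in> carrier R. x [^] (e::nat) = y} \<le> e"
proof (cases "{x \<in> carrier R. x [^] e = y} = {}")
  case True
  then show ?thesis by (simp only: card.empty)
next
  case False
  then obtain x0 where x0: "x0 \<in> carrier R" "x0 [^] e = y" by blast
  have nz: "x0 \<noteq> \<zero>" using x0 y e nat_pow_zero[of e] by auto
  have unit: "x0 \<in> Units R" using nz x0 by (simp add: field_Units)
  have "card {x \<in> carrier R. x [^] e = y} \<le> card (roots_of_unity e)"
  proof (rule card_inj_on_le)
    show "inj_on (\<lambda>x. inv x0 \<otimes> x) {x \<in> carrier R. x [^] e = y}"
      using Units_inv_Units[OF unit] by (intro inj_onI) (simp add: Units_l_cancel)
    have "(inv x0 \<otimes> x) [^] e = \<one>" if "x \<in> carrier R" "x [^] e = y" for x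
    proof -
      have "(inv x0 \<otimes> x) [^] e = (inv x0 \<otimes> x0) [^] e"
        using that x0 unit by (simp add: nat_pow_distrib del: Units_l_inv)
      then show ?thesis using unit by simp
    qed
    then show "(\<lambda>x. inv x0 \<otimes> x) ` {x \<in> carrier R. x [^] e = y} \<subseteq> roots_of_unity e"
      using unit by auto
    show "finite (roots_of_unity e)" using fin by simp
  qed
  also have "\<dots> \<le> e" using num_roots_le_deg[OF fin, of e] e by simp
  finally show ?thesis .
qed

text \<open>Double counting. The d e nonzero elements are distributed by x -> x^e over at most d
  values, with at most e elements over each, so both bounds must be attained.\<close>

lemma
  assumes de: "p ^ M - 1 = d * e"
  shows card_roots_of_unity: "card (roots_of_unity d) = d"
    and card_power_fibre: "y \<in> roots_of_unity d \<Longrightarrow> card {x \<in> carrier R. x [^] e = y} = e"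
proof -
  have d: "d > 0" and e: "e > 0" using de card_gt_1 by (auto intro!: Nat.gr0I)
  let ?Y = "roots_of_unity d" and ?F = "\<lambda>y. {x \<in> carrier R. x [^] e = y}"
  have Ynz: "y \<noteq> \<zero>" if "y \<in> ?Y" for y
    using that d nat_pow_zero[of d] by auto
  have finY: "finite ?Y" using fin by simp
  have le: "card (?F y) \<le> e" if "y \<in> ?Y" for y
    using power_fibre_le[OF e] that Ynz[OF that] by auto
  have Yd: "card ?Y \<le> d" using num_roots_le_deg[OF fin, of d] d by simp
  have U: "(\<Union>y\<in>?Y. ?F y) = carrier R - {\<zero>}"
  proof (intro equalityI subsetI)
    fix x assume "x \<in> (\<Union>y\<in>?Y. ?F y)"
    then show "x \<in> carrier R - {\<zero>}" using Ynz e nat_pow_zero[of e] by auto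
  next
    fix x assume x: "x \<in> carrier R - {\<zero>}"
    then have "(x [^] e) [^] d = \<one>"
      using pow_order_minus_one[unfolded de, of x] by (simp add: nat_pow_pow mult.commute)
    then show "x \<in> (\<Union>y\<in>?Y. ?F y)" using x by auto
  qed
  have "card (\<Union>y\<in>?Y. ?F y) = (\<Sum>y\<in>?Y. card (?F y))"
    using fin by (intro card_UN_disjoint) auto
  then have total: "(\<Sum>y\<in>?Y. card (?F y)) = d * e"
    using U card_R de fin by simp
  have "(\<Sum>y\<in>?Y. card (?F y)) \<le> card ?Y * e"
    using le sum_bounded_above[of ?Y "\<lambda>y. card (?F y)" e] by simp
  with total e have "d \<le> card ?Y" by simp
  with Yd show cY: "card ?Y = d" by simp
  have "(\<Sum>y\<in>?Y. card (?F y)) = (\<Sum>y\<in>?Y. e)" using total cY by simp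
  then show "card (?F y) = e" if "y \<in> ?Y" for y
    using sum_mono_inv[of "\<lambda>y. card (?F y)" ?Y "\<lambda>_. e" y] le that finY by blast
qed

text \<open>Groups the summands by the value of x^e. With d = q - 1 and e = q + 1 the power map is
  the norm to F_q.\<close>

lemma sum_power_map:
  fixes h :: "'a \<Rightarrow> complex"
  assumes de: "p ^ M - 1 = d * e"
  shows "(\<Sum>x\<in>carrier R - {\<zero>}. h (x [^] e)) = of_nat e * (\<Sum>y\<in>roots_of_unity d. h y)"
proof -
  have e: "e > 0" and d: "d > 0" using de card_gt_1 by (auto intro!: Nat.gr0I)
  have sub: "(\<lambda>x. x [^] e) ` (carrier R - {\<zero>}) \<subseteq> roots_of_unity d"
    using pow_order_minus_one[unfolded de] by (auto simp: nat_pow_pow mult.commute)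
  have "(\<Sum>x\<in>carrier R - {\<zero>}. h (x [^] e))
      = (\<Sum>y\<in>roots_of_unity d. \<Sum>x | x \<in> carrier R - {\<zero>} \<and> x [^] e = y. h (x [^] e))"
    using sub fin by (intro sum.group[symmetric]) auto
  also have "\<dots> = (\<Sum>y\<in>roots_of_unity d. of_nat e * h y)"
  proof (rule sum.cong[OF refl])
    fix y assume y: "y \<in> roots_of_unity d"
    have nz: "y \<noteq> \<zero>" using y d nat_pow_zero[of d] by auto
    have "{x. x \<in> carrier R - {\<zero>} \<and> x [^] e = y} = {x \<in> carrier R. x [^] e = y}"
      using nz e nat_pow_zero[of e] by auto
    then show "(\<Sum>x | x \<in> carrier R - {\<zero>} \<and> x [^] e = y. h (x [^] e)) = of_nat e * h y"
      using card_power_fibre[OF de y] by simp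
  qed
  finally show ?thesis by (simp add: sum_distrib_left)
qed

section \<open>Subfields\<close>

text \<open>For m > 0 with \<open>m dvd M\<close> this is the copy of F_{p^m} inside R. Closure
  under the field operations holds for every m, since x -> x^(p^m) is a ring endomorphism;
  divisibility enters only in the cardinality.\<close>

abbreviation subf :: "nat \<Rightarrow> 'a set" where
  "subf m \<equiv> subfield_pow R (p ^ m)"

lemma subf_M: "subf M = carrier R"
  using pow_order by (auto simp: subfield_pow_def)

lemma subf_carrier: "x \<in> subf m \<Longrightarrow> x \<in> carrier R"
  by (simp add: subfield_pow_def)

lemma finite_subf [simp]: "finite (subf m)"
  using fin by (simp add: subfield_pow_def)

lemma subf_zero [simp]: "\<zero> \<in> subf m" and subf_one [simp]: "\<one> \<in> subf m"
  by (auto simp: subfield_pow_def)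

lemma subf_add: "x \<in> subf m \<Longrightarrow> y \<in> subf m \<Longrightarrow> x \<oplus> y \<in> subf m"
  by (auto simp: subfield_pow_def add_pow_prime_power)

lemma subf_uminus: "x \<in> subf m \<Longrightarrow> \<ominus> x \<in> subf m"
  by (auto simp: subfield_pow_def minus_pow_prime_power)

lemma subf_mult: "x \<in> subf m \<Longrightarrow> y \<in> subf m \<Longrightarrow> x \<otimes> y \<in> subf m"
  by (auto simp: subfield_pow_def nat_pow_distrib)

lemma inv_nonzero:
  assumes "x \<in> carrier R" "x \<noteq> \<zero>"
  shows "inv x \<in> carrier R" "inv x \<noteq> \<zero>" "inv x \<otimes> x = \<one>" "x \<otimes> inv x = \<one>" "inv (inv x) = x"
proof -
  have "x \<in> Units R" using assms by (simp add: field_Units)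
  then show "inv x \<in> carrier R" "inv x \<noteq> \<zero>" "inv x \<otimes> x = \<one>" "x \<otimes> inv x = \<one>" "inv (inv x) = x"
    using Units_inv_Units[of x] by (auto simp: field_Units)
qed

lemma inv_nat_pow:
  assumes "x \<in> carrier R" "x \<noteq> \<zero>"
  shows "(inv x) [^] (n::nat) = inv (x [^] n)"
proof -
  have "(inv x) [^] n \<otimes> x [^] n = \<one>"
    using inv_nonzero[OF assms] assms by (simp add: nat_pow_distrib[symmetric])
  then show ?thesis using inv_nonzero[OF assms] assms inv_unique'
    by (metis inv_char m_comm nat_pow_closed)
qed

lemma subf_inv: "x \<in> subf m \<Longrightarrow> x \<noteq> \<zero> \<Longrightarrow> inv x \<in> subf m"
  by (auto simp: subfield_pow_def inv_nat_pow inv_nonzero)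

lemma subf_dvd:
  assumes "a dvd b" shows "subf a \<subseteq> subf b"
proof
  fix x assume "x \<in> subf a"
  then have x: "x \<in> carrier R" "x [^] (p ^ a) = x" by (auto simp: subfield_pow_def)
  have "x [^] (p ^ (a * k)) = x" for k
  proof (induction k)
    case (Suc k)
    have "x [^] (p ^ (a * Suc k)) = (x [^] (p ^ a)) [^] (p ^ (a * k))"
      using x(1) by (simp add: nat_pow_pow power_add)
    then show ?case using Suc x(2) by simp
  qed (use x in simp)
  with assms x show "x \<in> subf b" by (auto simp: subfield_pow_def)
qed

text \<open>Cancelling one factor x turns the fixed-point equation into a root-of-unity condition,
  which makes subfields accessible to \<open>card_roots_of_unity\<close>.\<close>

lemma subf_minus_zero:
  assumes m: "m > 0"
  shows "subf m - {\<zero>} = roots_of_unity (p ^ m - 1)"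
proof -
  have gt: "p ^ m > 1" using m p_ge_2 by (metis one_less_power One_nat_def Suc_1 Suc_le_lessD)
  then have S: "p ^ m = Suc (p ^ m - 1)" by simp
  have "x [^] (p ^ m) = x \<longleftrightarrow> x [^] (p ^ m - 1) = \<one>" if "x \<in> carrier R" "x \<noteq> \<zero>" for x
  proof -
    have "x [^] (p ^ m) = x [^] (p ^ m - 1) \<otimes> x" by (subst S) simp
    then have "x [^] (p ^ m) = x \<longleftrightarrow> x [^] (p ^ m - 1) \<otimes> x = \<one> \<otimes> x" using that by simp
    also have "\<dots> \<longleftrightarrow> x [^] (p ^ m - 1) = \<one>" using that by (subst m_rcancel) auto
    finally show ?thesis .
  qed
  moreover have "\<zero> [^] (p ^ m - 1) \<noteq> \<one>"
    using nat_pow_zero[of "p ^ m - 1"] gt by simp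
  ultimately show ?thesis by (auto simp: subfield_pow_def)
qed

lemma card_subf:
  assumes "m > 0" "m dvd M"
  shows "card (subf m) = p ^ m"
proof -
  obtain k where k: "M = m * k" using assms(2) ..
  have "p ^ m - 1 dvd p ^ M - 1"
    using minus_one_dvd_power_minus_one[of "p ^ m" k] p_ge_2 by (simp add: k power_mult)
  then obtain e where "p ^ M - 1 = (p ^ m - 1) * e" ..
  then have "card (subf m - {\<zero>}) = p ^ m - 1"
    unfolding subf_minus_zero[OF assms(1)] by (rule card_roots_of_unity)
  then have "card (subf m) = Suc (p ^ m - 1)"
    using card_Suc_Diff1[of "subf m" \<zero>] by (simp only: finite_subf subf_zero)
  then show ?thesis using p_ge_2 by simp
qed


section \<open>Traces\<close>

lemma rel_trace_closed [simp]: "x \<in> carrier R \<Longrightarrow> rel_trace R r s x \<in> carrier R"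
  by (auto simp: rel_trace_def intro!: finsum_closed)

lemma rel_trace_0 [simp]: "rel_trace R r 0 x = \<zero>"
  by (simp add: rel_trace_def)

lemma rel_trace_Suc:
  "x \<in> carrier R \<Longrightarrow> rel_trace R r (Suc s) x = rel_trace R r s x \<oplus> x [^] (r ^ s)"
  by (simp add: rel_trace_def lessThan_Suc a_comm)

text \<open>Cutting the trace sum after a terms yields Frobenius invariance, transitivity, and the
  descent from F_{q^2} to F_q.\<close>

lemma rel_trace_plus:
  assumes x: "x \<in> carrier R"
  shows "rel_trace R r (a + b) x = rel_trace R r a x \<oplus> rel_trace R r b (x [^] (r ^ a))"
proof (induction b)
  case 0
  then show ?case using x by simp
next
  case (Suc b)
  then show ?case using x
    by (simp add: rel_trace_Suc nat_pow_pow power_add a_assoc)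
qed

lemma rel_trace_add:
  assumes x: "x \<in> carrier R" "y \<in> carrier R"
  shows "rel_trace R (p ^ k) s (x \<oplus> y) = rel_trace R (p ^ k) s x \<oplus> rel_trace R (p ^ k) s y"
proof (induction s)
  case (Suc s)
  have "(x \<oplus> y) [^] ((p ^ k) ^ s) = x [^] ((p ^ k) ^ s) \<oplus> y [^] ((p ^ k) ^ s)"
    using add_pow_prime_power[OF x, of "k * s"] by (simp add: power_mult)
  then show ?case using Suc x by (simp add: rel_trace_Suc a_ac)
qed simp

lemma rel_trace_smult:
  assumes u: "u \<in> subf k" and x: "x \<in> carrier R"
  shows "rel_trace R (p ^ k) s (u \<otimes> x) = u \<otimes> rel_trace R (p ^ k) s x"
proof (induction s)
  case 0
  then show ?case using subf_carrier[OF u] by simp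
next
  case (Suc s)
  have "u [^] ((p ^ k) ^ s) = u"
    using subf_dvd[of k "k * s"] u by (auto simp: subfield_pow_def power_mult)
  then show ?case using Suc x subf_carrier[OF u]
    by (simp add: rel_trace_Suc nat_pow_distrib r_distr)
qed

lemma rel_trace_in_subf:
  assumes x: "x \<in> subf (k * s)"
  shows "rel_trace R (p ^ k) s x \<in> subf k"
proof -
  have xc: "x \<in> carrier R" using x by (rule subf_carrier)
  have "rel_trace R (p ^ k) n x [^] (p ^ k) = rel_trace R (p ^ k) n (x [^] (p ^ k))" for n
    using xc by (induction n)
      (simp_all add: rel_trace_Suc add_pow_prime_power nat_pow_pow mult.commute)
  \<comment> \<open>Frobenius permutes the summands cyclically. The sum of the first s + 1
    conjugates is split once at its first and once at its last term, and both of these equal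
    x.\<close>
  moreover have "rel_trace R (p ^ k) s (x [^] (p ^ k)) = rel_trace R (p ^ k) s x"
  proof -
    have "x \<oplus> rel_trace R (p ^ k) s (x [^] (p ^ k)) = rel_trace R (p ^ k) (1 + s) x"
      using xc by (subst rel_trace_plus) (simp_all add: rel_trace_Suc)
    also have "\<dots> = rel_trace R (p ^ k) s x \<oplus> x"
      using xc x by (simp add: rel_trace_Suc subfield_pow_def power_mult)
    finally show ?thesis using xc by (simp add: a_comm[of _ x])
  qed
  ultimately show ?thesis using xc by (simp add: subfield_pow_def)
qed

text \<open>Every exponent below t s is uniquely i + t j with i < t and j < s, so this is an
  identity of additive polynomials, valid on all of R rather than only on F_q.\<close>

lemma rel_trace_tower:
  assumes x: "x \<in> carrier R"
  shows "rel_trace R p t (rel_trace R (p ^ t) s x) = rel_trace R p (t * s) x"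
proof (induction s)
  case 0
  have "rel_trace R p t \<zero> = \<zero>"
    by (induction t) (simp_all add: rel_trace_Suc)
  then show ?case by simp
next
  case (Suc s)
  have "rel_trace R p t (rel_trace R (p ^ t) (Suc s) x)
      = rel_trace R p (t * s) x \<oplus> rel_trace R p t (x [^] (p ^ (t * s)))"
    using rel_trace_add[of "rel_trace R (p ^ t) s x" "x [^] (p ^ (t * s))" 1 t] x Suc
    by (simp add: rel_trace_Suc power_mult)
  also have "\<dots> = rel_trace R p (t * Suc s) x"
    using rel_trace_plus[OF x, of p "t * s" t] by (simp add: add.commute)
  finally show ?case .
qed

text \<open>The equation y^j = 1 has at most j solutions, fewer than there are nonzero elements in
  the subfield, so some h in it has h^j <> 1. Multiplication by h permutes the summation range,
  whence the sum S satisfies S = h^j S.\<close>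

lemma power_sum_zero:
  assumes m: "m > 0" "m dvd M" and j: "0 < j" "j < p ^ m - 1"
  shows "(\<Oplus>y\<in>subf m - {\<zero>}. y [^] j) = \<zero>"
proof -
  let ?Y = "subf m - {\<zero>}"
  have Yc: "?Y \<subseteq> carrier R" using subf_carrier by blast
  have "card (roots_of_unity j) < card ?Y"
    using num_roots_le_deg[OF fin, of j] j card_subf[OF m] by simp
  then have "\<not> ?Y \<subseteq> roots_of_unity j"
    using card_mono[of "roots_of_unity j" ?Y] fin by auto
  then obtain h where h: "h \<in> ?Y" "h [^] j \<noteq> \<one>" using Yc by blast
  have hc: "h \<in> carrier R" using h Yc by blast
  have inj: "inj_on (\<lambda>y. h \<otimes> y) ?Y"
    using h hc Yc m_lcancel[of h] by (intro inj_onI) auto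
  have "(\<lambda>y. h \<otimes> y) ` ?Y \<subseteq> ?Y"
    using h Yc hc subf_mult integral by (auto simp: subset_iff) blast
  then have im: "(\<lambda>y. h \<otimes> y) ` ?Y = ?Y"
    by (intro endo_inj_surj inj) auto
  let ?S = "\<Oplus>y\<in>?Y. y [^] j"
  have Sc: "?S \<in> carrier R" using Yc by (intro finsum_closed) auto
  have "?S = (\<Oplus>y\<in>(\<lambda>y. h \<otimes> y) ` ?Y. y [^] j)" by (simp only: im)
  also have "\<dots> = (\<Oplus>y\<in>?Y. (h \<otimes> y) [^] j)"
    using Yc hc by (intro finsum_reindex inj) auto
  also have "\<dots> = (\<Oplus>y\<in>?Y. h [^] j \<otimes> y [^] j)"
    using Yc hc by (intro finsum_cong') (auto simp: nat_pow_distrib)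
  also have "\<dots> = h [^] j \<otimes> ?S"
    using Yc hc by (intro finsum_rdistr[symmetric]) auto
  finally have "h [^] j \<otimes> ?S = \<one> \<otimes> ?S" using Sc by simp
  then show ?thesis using h hc Sc m_rcancel[of ?S "h [^] j" \<one>] by auto
qed

text \<open>Pairing the trace polynomial with \<^term>\<open>y [^] (p ^ m - 2)\<close> kills all power sums
  except the one coming from the linear term, which equals \<^term>\<open>\<ominus> \<one>\<close>.\<close>

lemma rel_trace_nonzero:
  assumes m: "m > 0" "m dvd M"
  shows "\<exists>y\<in>subf m. rel_trace R p m y \<noteq> \<zero>"
proof (rule ccontr)
  assume "\<not> (\<exists>y\<in>subf m. rel_trace R p m y \<noteq> \<zero>)"
  then have T0: "rel_trace R p m y = \<zero>" if "y \<in> subf m" for y using that by blast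
  let ?Y = "subf m - {\<zero>}" and ?d = "p ^ m - 1"
  have Yc: "?Y \<subseteq> carrier R" using subf_carrier by blast
  have d: "?d > 0" using one_less_power[of p m] p_ge_2 m by simp
  have Yd: "y [^] ?d = \<one>" if "y \<in> ?Y" for y
    using that unfolding subf_minus_zero[OF m(1)] by blast
  have step: "(\<Oplus>y\<in>?Y. rel_trace R p (Suc n) y \<otimes> y [^] (?d - 1)) = [?d] \<cdot> \<one>"
    if "n < m" for n
    using that
  proof (induction n)
    case 0
    have "(\<Oplus>y\<in>?Y. rel_trace R p (Suc 0) y \<otimes> y [^] (?d - 1)) = (\<Oplus>y\<in>?Y. \<one>)"
    proof (rule finsum_cong')
      fix y assume y: "y \<in> ?Y"
      then have yc: "y \<in> carrier R" using Yc by blast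
      have "y \<otimes> y [^] (?d - 1) = y [^] Suc (?d - 1)"
        using yc by (simp add: m_comm)
      also have "Suc (?d - 1) = ?d" using d by simp
      finally have "y \<otimes> y [^] (?d - 1) = \<one>" using Yd[OF y] by simp
      then show "rel_trace R p (Suc 0) y \<otimes> y [^] (?d - 1) = \<one>"
        using yc by (simp add: rel_trace_Suc)
    qed auto
    also have "\<dots> = [?d] \<cdot> \<one>"
      using add.finprod_const[of \<one> ?Y] card_subf[OF m] by simp
    finally show ?case .
  next
    case (Suc n)
    let ?j = "p ^ Suc n - 1"
    have j: "0 < ?j" "?j < ?d"
      using one_less_power[of p "Suc n"] power_strict_increasing[of "Suc n" m p] Suc.prems p_ge_2
      by auto
    \<comment> \<open>As y^?d = 1 on the nonzero elements, the new summand contributes only y^?j,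
      and ?j lies in the range covered by \<open>power_sum_zero\<close>.\<close>
    have e: "p ^ Suc n + (?d - 1) = ?d + ?j"
      using j d by linarith
    have "(\<Oplus>y\<in>?Y. rel_trace R p (Suc (Suc n)) y \<otimes> y [^] (?d - 1))
        = (\<Oplus>y\<in>?Y. rel_trace R p (Suc n) y \<otimes> y [^] (?d - 1) \<oplus> y [^] ?j)"
    proof (rule finsum_cong')
      fix y assume y: "y \<in> ?Y"
      then have yc: "y \<in> carrier R" using Yc by blast
      have "y [^] (p ^ Suc n) \<otimes> y [^] (?d - 1) = y [^] ?d \<otimes> y [^] ?j"
        using yc by (simp only: nat_pow_mult e)
      then have *: "y [^] (p ^ Suc n) \<otimes> y [^] (?d - 1) = y [^] ?j" using yc Yd[OF y] by simp
      show "rel_trace R p (Suc (Suc n)) y \<otimes> y [^] (?d - 1)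
          = rel_trace R p (Suc n) y \<otimes> y [^] (?d - 1) \<oplus> y [^] ?j"
        unfolding rel_trace_Suc[OF yc, of p "Suc n"] *[symmetric]
        using yc by (intro l_distr) auto
    qed (use Yc in auto)
    also have "\<dots> = (\<Oplus>y\<in>?Y. rel_trace R p (Suc n) y \<otimes> y [^] (?d - 1)) \<oplus> (\<Oplus>y\<in>?Y. y [^] ?j)"
      using Yc by (intro finsum_addf) auto
    also have "\<dots> = [?d] \<cdot> \<one>" using Suc power_sum_zero[OF m j] by simp
    finally show ?case .
  qed
  have "(\<Oplus>y\<in>?Y. rel_trace R p m y \<otimes> y [^] (?d - 1)) = (\<Oplus>y\<in>?Y. \<zero>)"
    using T0 Yc by (intro finsum_cong') auto
  then have dz: "[?d] \<cdot> \<one> = \<zero>" using step[of "m - 1"] m by simp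
  \<comment> \<open>Since p^m = ?d + 1 annihilates \<open>\<one>\<close>, the vanishing of
    \<open>[?d] \<cdot> \<one>\<close> would force \<open>\<one> = \<zero>\<close>.\<close>
  have "[(p * p ^ (m - 1))] \<cdot> \<one> = \<zero>"
    using add.nat_pow_pow[of \<one> "p ^ (m - 1)" p] char_p by simp
  moreover have "p * p ^ (m - 1) = ?d + 1" using m d power_Suc[of p "m - 1"] by simp
  ultimately have "[?d] \<cdot> \<one> \<oplus> [(1::nat)] \<cdot> \<one> = \<zero>"
    using add_pow_add[of \<one> ?d 1] by simp
  then show False using dz by simp
qed


section \<open>Additive characters\<close>

lemma add_pow_one_eq_zero_iff: "[n] \<cdot> \<one> = \<zero> \<longleftrightarrow> p dvd n"
proof
  assume "p dvd n"
  then obtain k where "n = p * k" ..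
  then show "[n] \<cdot> \<one> = \<zero>"
    using add.nat_pow_pow[of \<one> k p] char_p by simp
next
  assume n: "[n] \<cdot> \<one> = \<zero>"
  show "p dvd n"
  proof (rule ccontr)
    assume nd: "\<not> p dvd n"
    then have "coprime n p" using prime_p by (metis coprime_commute prime_imp_coprime)
    moreover have "n \<noteq> 0" using nd by (metis dvd_0_right)
    \<comment> \<open>Bezout: if both n and p annihilated \<open>\<one>\<close>, then n x = p y + 1
      would give \<open>\<one> = \<zero>\<close>.\<close>
    ultimately obtain x y where xy: "n * x = p * y + 1"
      using bezout_nat[of n p] by auto
    have "[(p * y + 1)] \<cdot> \<one> = [(p * y)] \<cdot> \<one> \<oplus> [(1::nat)] \<cdot> \<one>"
      by (rule add_pow_add) simp
    moreover have "[(p * y)] \<cdot> \<one> = \<zero>"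
      using add.nat_pow_pow[of \<one> y p] char_p by simp
    moreover have "[(n * x)] \<cdot> \<one> = \<zero>"
      using add.nat_pow_pow[of \<one> x n] n by simp
    ultimately show False using xy by simp
  qed
qed

text \<open>The multiples of \<open>\<one>\<close> by 0, ..., p - 1 are distinct and lie in
  \<open>subf 1\<close>, which has exactly p elements, so they exhaust it. This makes the
  description in \<open>prime_field_rep\<close> proper.\<close>

lemma prime_field_rep_works:
  assumes y: "y \<in> subf 1"
  shows "prime_field_rep R p y < p" "[(prime_field_rep R p y)] \<cdot> \<one> = y"
proof -
  have inj': "i = j" if "i \<le> j" "j < p" "[i] \<cdot> \<one> = [j] \<cdot> \<one>" for i j :: nat
  proof -
    have "[i] \<cdot> \<one> \<oplus> \<zero> = [i] \<cdot> \<one> \<oplus> [(j - i)] \<cdot> \<one>"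
      using add_pow_add[of \<one> i "j - i"] that by simp
    then have "[(j - i)] \<cdot> \<one> = \<zero>"
      using add.l_cancel[of "[i] \<cdot> \<one>" \<zero> "[(j - i)] \<cdot> \<one>"] by simp
    then have "p dvd j - i" by (simp add: add_pow_one_eq_zero_iff)
    then show ?thesis using that by (auto dest: dvd_imp_le)
  qed
  then have inj: "inj_on (\<lambda>k::nat. [k] \<cdot> \<one>) {..<p}"
    by (intro inj_onI) (metis lessThan_iff linear)
  have mem: "[k] \<cdot> \<one> \<in> subf 1" for k :: nat
    using subf_zero[of 1] subf_one[of 1] subf_add[of _ 1 \<one>] by (induction k) simp_all
  have "(\<lambda>k::nat. [k] \<cdot> \<one>) ` {..<p} = subf 1"
  proof (rule card_subset_eq[OF finite_subf])
    show "(\<lambda>k::nat. [k] \<cdot> \<one>) ` {..<p} \<subseteq> subf 1" using mem by blast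
    show "card ((\<lambda>k::nat. [k] \<cdot> \<one>) ` {..<p}) = card (subf 1)"
      using card_subf[OF zero_less_one one_dvd]
      by (simp only: card_image[OF inj] card_lessThan power_one_right)
  qed
  with y have "y \<in> (\<lambda>k::nat. [k] \<cdot> \<one>) ` {..<p}" by (simp only:)
  then obtain k where k: "k < p" "[k] \<cdot> \<one> = y" by auto
  have "prime_field_rep R p y = k"
    unfolding prime_field_rep_def
    using k inj by (intro the_equality) (auto dest: inj_onD)
  then show "prime_field_rep R p y < p" "[(prime_field_rep R p y)] \<cdot> \<one> = y"
    using k by auto
qed

lemma root_unity_power_eq_1_iff: "exp (2 * pi * \<i> / of_nat p) ^ n = 1 \<longleftrightarrow> p dvd n"
proof -
  have "exp (2 * pi * \<i> / of_nat p) ^ n = exp (2 * of_real pi * \<i> * of_nat n / of_nat p)"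
    by (simp add: exp_of_nat_mult[symmetric] mult_ac)
  then show ?thesis using complex_root_unity_eq_1[of p n] p_ge_2 by simp
qed

text \<open>Allows representatives of the trace that are not reduced mod p; additivity needs this,
  since the sum of two reduced representatives may exceed p - 1.\<close>

lemma add_char_of_nat:
  assumes "[n] \<cdot> \<one> = abs_trace R p m x" "x \<in> subf m"
  shows "add_char R p m x = exp (2 * pi * \<i> / of_nat p) ^ n"
proof -
  let ?w = "exp (2 * pi * \<i> / of_nat p)"
  let ?k = "prime_field_rep R p (abs_trace R p m x)"
  have "abs_trace R p m x \<in> subf 1"
    using rel_trace_in_subf[of x 1 m] assms(2) by (simp add: abs_trace_def rel_trace_def)
  then have k: "?k < p" "[?k] \<cdot> \<one> = [n] \<cdot> \<one>"
    using prime_field_rep_works[of "abs_trace R p m x"] assms(1) by auto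
  have *: "?w ^ a = ?w ^ b" if "a \<le> b" "[a] \<cdot> \<one> = [b] \<cdot> \<one>" for a b :: nat
  proof -
    have "[a] \<cdot> \<one> \<oplus> \<zero> = [a] \<cdot> \<one> \<oplus> [(b - a)] \<cdot> \<one>"
      using add_pow_add[of \<one> a "b - a"] that by simp
    then have "[(b - a)] \<cdot> \<one> = \<zero>"
      using add.l_cancel[of "[a] \<cdot> \<one>" \<zero> "[(b - a)] \<cdot> \<one>"] by simp
    then have "p dvd b - a" by (simp only: add_pow_one_eq_zero_iff)
    then have "?w ^ (b - a) = 1" by (simp only: root_unity_power_eq_1_iff)
    then show ?thesis using power_add[of ?w a "b - a"] that by simp
  qed
  show ?thesis
    unfolding add_char_def using *[of ?k n] *[of n ?k] k(2) by (metis linear)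
qed

lemma abs_trace_eq: "abs_trace R p m x = rel_trace R p m x"
  by (simp add: abs_trace_def rel_trace_def)

lemma obtain_trace_nat:
  assumes "x \<in> subf m"
  obtains n :: nat where "[n] \<cdot> \<one> = abs_trace R p m x"
    "add_char R p m x = exp (2 * pi * \<i> / of_nat p) ^ n"
proof -
  have "abs_trace R p m x \<in> subf 1"
    using rel_trace_in_subf[of x 1 m] assms by (simp add: abs_trace_eq)
  then have "[(prime_field_rep R p (abs_trace R p m x))] \<cdot> \<one> = abs_trace R p m x"
    by (rule prime_field_rep_works)
  then show ?thesis using that add_char_of_nat assms by blast
qed

lemma add_char_add:
  assumes x: "x \<in> subf m" "y \<in> subf m"
  shows "add_char R p m (x \<oplus> y) = add_char R p m x * add_char R p m y"
proof -
  let ?w = "exp (2 * pi * \<i> / of_nat p)"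
  obtain a where a: "[a] \<cdot> \<one> = abs_trace R p m x" "add_char R p m x = ?w ^ a"
    using obtain_trace_nat[OF x(1)] .
  obtain b where b: "[b] \<cdot> \<one> = abs_trace R p m y" "add_char R p m y = ?w ^ b"
    using obtain_trace_nat[OF x(2)] .
  have "[(a + b)] \<cdot> \<one> = abs_trace R p m (x \<oplus> y)"
    using add_pow_add[of \<one> a b] a(1) b(1) rel_trace_add[of x y 1 m] subf_carrier x
    by (simp add: abs_trace_eq)
  then have "add_char R p m (x \<oplus> y) = ?w ^ (a + b)"
    using add_char_of_nat subf_add x by blast
  then show ?thesis using a b by (simp add: power_add)
qed

lemma norm_add_char [simp]: "cmod (add_char R p m x) = 1"
  by (simp add: add_char_def norm_power)

lemma add_char_zero [simp]: "add_char R p m \<zero> = 1"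
proof -
  have "add_char R p m \<zero> * add_char R p m \<zero> = add_char R p m \<zero> * 1"
    using add_char_add[of \<zero> m \<zero>] by simp
  moreover have "add_char R p m \<zero> \<noteq> 0" using norm_add_char[of m \<zero>] by (metis norm_zero zero_neq_one)
  ultimately show ?thesis by (metis mult_left_cancel)
qed

lemma add_char_uminus:
  assumes x: "x \<in> subf m"
  shows "add_char R p m (\<ominus> x) = cnj (add_char R p m x)"
proof -
  have "add_char R p m x * add_char R p m (\<ominus> x) = 1"
    using add_char_add[OF x subf_uminus[OF x]] subf_carrier[OF x] by (simp add: r_neg)
  moreover have "add_char R p m x * cnj (add_char R p m x) = 1"
    using complex_norm_square[of "add_char R p m x"] by simp
  moreover have "add_char R p m x \<noteq> 0" using norm_add_char[of m x] by (metis norm_zero zero_neq_one)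
  ultimately show ?thesis by (metis mult_left_cancel)
qed

lemma add_char_nontrivial:
  assumes "m > 0" "m dvd M"
  shows "\<exists>y\<in>subf m. add_char R p m y \<noteq> 1"
proof -
  obtain y where y: "y \<in> subf m" "abs_trace R p m y \<noteq> \<zero>"
    using rel_trace_nonzero[OF assms] by (auto simp: abs_trace_eq)
  obtain n where n: "[n] \<cdot> \<one> = abs_trace R p m y"
    "add_char R p m y = exp (2 * pi * \<i> / of_nat p) ^ n"
    using obtain_trace_nat[OF y(1)] .
  then have "add_char R p m y \<noteq> 1"
    using y(2) add_pow_one_eq_zero_iff root_unity_power_eq_1_iff by metis
  then show ?thesis using y by blast
qed

lemma bij_betw_add_subf: "a \<in> subf m \<Longrightarrow> bij_betw (\<lambda>x. x \<oplus> a) (subf m) (subf m)"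
proof -
  assume a: "a \<in> subf m"
  have inj: "inj_on (\<lambda>x. x \<oplus> a) (subf m)"
    using a subf_carrier by (intro inj_onI) (simp add: add.r_cancel subf_carrier)
  moreover have "(\<lambda>x. x \<oplus> a) ` subf m = subf m"
    using a subf_add by (intro endo_inj_surj inj) auto
  ultimately show ?thesis by (simp add: bij_betw_def)
qed

lemma bij_betw_mult_subf:
  assumes c: "c \<in> subf m" "c \<noteq> \<zero>" shows "bij_betw (\<lambda>x. x \<otimes> c) (subf m) (subf m)"
proof -
  have inj: "inj_on (\<lambda>x. x \<otimes> c) (subf m)"
    using c subf_carrier by (intro inj_onI) (simp add: m_rcancel subf_carrier)
  moreover have "(\<lambda>x. x \<otimes> c) ` subf m = subf m"
    using c subf_mult by (intro endo_inj_surj inj) auto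
  ultimately show ?thesis by (simp add: bij_betw_def)
qed

text \<open>For c <> 0 scaling by c permutes the subfield. Translating by a y with character value
  <> 1 then multiplies the sum by that value, so the sum is 0.\<close>

lemma sum_add_char:
  assumes m: "m > 0" "m dvd M" and c: "c \<in> subf m"
  shows "(\<Sum>u\<in>subf m. add_char R p m (u \<otimes> c)) = (if c = \<zero> then of_nat (p ^ m) else 0)"
proof (cases "c = \<zero>")
  case True
  then show ?thesis using card_subf[OF m] subf_carrier by simp
next
  case False
  let ?S = "\<Sum>u\<in>subf m. add_char R p m u"
  obtain y where y: "y \<in> subf m" "add_char R p m y \<noteq> 1"
    using add_char_nontrivial[OF m] by blast
  have "?S = (\<Sum>u\<in>subf m. add_char R p m (u \<oplus> y))"
    using sum.reindex_bij_betw[OF bij_betw_add_subf[OF y(1)], of "add_char R p m"] by simp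
  also have "\<dots> = (\<Sum>u\<in>subf m. add_char R p m u * add_char R p m y)"
    using y by (intro sum.cong) (auto simp: add_char_add)
  also have "\<dots> = ?S * add_char R p m y" by (simp add: sum_distrib_right)
  finally have "?S = 0" using y by (metis mult_cancel_left1)
  then show ?thesis
    using sum.reindex_bij_betw[OF bij_betw_mult_subf[OF c False], of "add_char R p m"] False by simp
qed

text \<open>Parseval for the indicator of E: expand the square and let orthogonality keep the
  diagonal. It serves twice, for the nonsquares in F_r and for D in the whole field.\<close>

lemma sum_norm_char_sum:
  assumes m: "m > 0" "m dvd M" and E: "E \<subseteq> subf m"
  shows "(\<Sum>u\<in>subf m. (cmod (\<Sum>c\<in>E. add_char R p m (u \<otimes> c)))\<^sup>2) = real (p ^ m * card E)"
proof -
  have finE: "finite E" using finite_subset[OF E finite_subf] .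
  have Ec: "E \<subseteq> carrier R" using E subf_carrier by blast
  have "complex_of_real (\<Sum>u\<in>subf m. (cmod (\<Sum>c\<in>E. add_char R p m (u \<otimes> c)))\<^sup>2)
      = (\<Sum>u\<in>subf m. \<Sum>c\<in>E. \<Sum>c'\<in>E. add_char R p m (u \<otimes> (c \<ominus> c')))"
  proof -
    have *: "add_char R p m (u \<otimes> (c \<ominus> c')) = add_char R p m (u \<otimes> c) * cnj (add_char R p m (u \<otimes> c'))"
      if "u \<in> subf m" "c \<in> E" "c' \<in> E" for u c c'
    proof -
      have "u \<in> carrier R" "c \<in> carrier R" "c' \<in> carrier R"
        using that Ec subf_carrier by auto
      then have "u \<otimes> (c \<ominus> c') = u \<otimes> c \<oplus> \<ominus> (u \<otimes> c')" by algebra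
      moreover have "u \<otimes> c \<in> subf m" "u \<otimes> c' \<in> subf m" using that E subf_mult by auto
      ultimately show ?thesis by (simp add: add_char_add add_char_uminus subf_uminus)
    qed
    show ?thesis
      by (simp add: complex_norm_square sum_product * del: of_real_power)
  qed
  also have "\<dots> = (\<Sum>c\<in>E. \<Sum>c'\<in>E. \<Sum>u\<in>subf m. add_char R p m (u \<otimes> (c \<ominus> c')))"
    by (subst sum.swap, rule sum.cong[OF refl], rule sum.swap)
  also have "\<dots> = (\<Sum>c\<in>E. \<Sum>c'\<in>E. if c = c' then of_nat (p ^ m) else 0)"
  proof (intro sum.cong refl)
    fix c c' assume c: "c \<in> E" "c' \<in> E"
    then have "c \<ominus> c' \<in> subf m" using E by (auto simp: a_minus_def intro: subf_add subf_uminus)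
    moreover have "c \<ominus> c' = \<zero> \<longleftrightarrow> c = c'" using c Ec by (simp add: subset_iff)
    ultimately show "(\<Sum>u\<in>subf m. add_char R p m (u \<otimes> (c \<ominus> c')))
        = (if c = c' then of_nat (p ^ m) else 0)"
      using sum_add_char[OF m] by simp
  qed
  also have "\<dots> = of_real (real (p ^ m * card E))"
    using finE by (simp add: sum.delta)
  finally show ?thesis by (simp only: of_real_eq_iff)
qed

end

locale trace_norm_form = finite_field_order R p "2 * t * s" for R (structure) and p t s +
  assumes odd_p: "odd p" and t_pos: "t > 0" and s_pos: "s > 0"
begin

abbreviation r :: nat where "r \<equiv> p ^ t"
abbreviation q :: nat where "q \<equiv> p ^ (t * s)"
abbreviation psi_r :: "'a \<Rightarrow> complex" where "psi_r \<equiv> add_char R p t"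
abbreviation psi_q :: "'a \<Rightarrow> complex" where "psi_q \<equiv> add_char R p (t * s)"
abbreviation chi :: "'a \<Rightarrow> complex" where "chi \<equiv> add_char R p (2 * t * s)"
abbreviation nrm :: "'a \<Rightarrow> 'a" where "nrm x \<equiv> x [^] (q + 1)"
abbreviation Q :: "'a \<Rightarrow> 'a" where "Q x \<equiv> rel_trace R r s (nrm x)"

section \<open>The quadratic form\<close>

lemma ts_pos: "t * s > 0" using t_pos s_pos by simp
lemma ts_dvd: "t * s dvd 2 * t * s" by simp
lemma t_dvd: "t dvd 2 * t * s" by simp
lemma M_gt_0: "2 * t * s > 0" using ts_pos by simp

lemma q_sq: "q * q = p ^ (2 * t * s)"
proof -
  have "t * s + t * s = 2 * t * s" by simp
  then show ?thesis by (metis power_add)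
qed

lemma pow_q_q: "x \<in> carrier R \<Longrightarrow> (x [^] q) [^] q = x"
  using pow_order[of x] by (simp only: nat_pow_pow q_sq)

lemma nrm_in_subf: "x \<in> carrier R \<Longrightarrow> nrm x \<in> subf (t * s)"
  using pow_q_q[of x] by (simp add: subfield_pow_def nat_pow_distrib m_comm)

lemma Q_in_subf: "x \<in> carrier R \<Longrightarrow> Q x \<in> subf t"
  using nrm_in_subf by (intro rel_trace_in_subf) blast

lemma subf_t_q: "u \<in> subf t \<Longrightarrow> u \<in> subf (t * s)"
  using subf_dvd[of t "t * s"] by auto

text \<open>An element u of F_r passes through the trace from F_q to F_r, and transitivity of the
  trace does the rest. Characters of \<open>Q\<close> thereby become characters of the norm on
  F_q.\<close>

lemma psi_r_Q:
  assumes u: "u \<in> subf t" and x: "x \<in> carrier R"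
  shows "psi_r (u \<otimes> Q x) = psi_q (u \<otimes> nrm x)"
proof -
  have "u \<otimes> Q x = rel_trace R r s (u \<otimes> nrm x)"
    using rel_trace_smult[OF u, of "nrm x" s] x by simp
  moreover have "rel_trace R p t \<dots> = rel_trace R p (t * s) (u \<otimes> nrm x)"
    using u x subf_carrier by (intro rel_trace_tower) auto
  ultimately show ?thesis by (simp only: add_char_def abs_trace_eq)
qed

text \<open>The trace from F_{q^2} to F_q is y + y^q. In this form the linear term has the shape of
  the cross terms of a norm.\<close>

lemma chi_eq_psi_q:
  assumes y: "y \<in> carrier R"
  shows "chi y = psi_q (y \<oplus> y [^] q)"
proof -
  have "rel_trace R p (t * s + t * s) y = rel_trace R p (t * s) (y \<oplus> y [^] q)"
    using rel_trace_plus[OF y, of p "t * s" "t * s"] rel_trace_add[of y "y [^] q" 1 "t * s"] y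
    by simp
  moreover have "2 * t * s = t * s + t * s" by simp
  ultimately show ?thesis by (simp only: add_char_def abs_trace_eq)
qed

text \<open>The nonzero values of a nontrivial character of F_q sum to -1, each nonzero norm occurs
  q + 1 times, and x = 0 contributes 1: the total is 1 - (q + 1).\<close>

lemma sum_psi_q_nrm:
  assumes v: "v \<in> subf (t * s)" "v \<noteq> \<zero>"
  shows "(\<Sum>x\<in>carrier R. psi_q (v \<otimes> nrm x)) = - of_nat q"
proof -
  have vc: "v \<in> carrier R" using v subf_carrier by blast
  have de: "p ^ (2 * t * s) - 1 = (q - 1) * (q + 1)"
    unfolding q_sq[symmetric] using p_ge_2 by (simp add: algebra_simps)
  have "(\<Sum>x\<in>carrier R - {\<zero>}. psi_q (v \<otimes> nrm x))
      = of_nat (q + 1) * (\<Sum>y\<in>roots_of_unity (q - 1). psi_q (v \<otimes> y))"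
    by (rule sum_power_map[OF de])
  also have "(\<Sum>y\<in>roots_of_unity (q - 1). psi_q (v \<otimes> y))
      = (\<Sum>y\<in>subf (t * s) - {\<zero>}. psi_q (v \<otimes> y))"
    by (simp only: subf_minus_zero[OF ts_pos])
  also have "\<dots> = (\<Sum>y\<in>subf (t * s) - {\<zero>}. psi_q (y \<otimes> v))"
    using vc subf_carrier by (intro sum.cong refl) (auto simp: m_comm)
  also have "\<dots> = - 1"
    using sum_add_char[OF ts_pos ts_dvd v(1)] v vc
      sum.remove[of "subf (t * s)" \<zero> "\<lambda>y. psi_q (y \<otimes> v)"]
    by (simp add: add_eq_0_iff)
  finally have "(\<Sum>x\<in>carrier R - {\<zero>}. psi_q (v \<otimes> nrm x)) = - of_nat (q + 1)" by simp
  moreover have "nrm \<zero> = \<zero>" by simp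
  ultimately show ?thesis
    using sum.remove[OF fin zero_closed, of "\<lambda>x. psi_q (v \<otimes> nrm x)"] vc
    by (simp del: nat_pow_Suc)
qed

text \<open>Completing the norm: with \<^term>\<open>b = a [^] q \<otimes> inv u\<close> one has
  \<open>u N(x - b) = u N(x) - (a x + (a x)^q) + N(a) / u\<close>.\<close>

lemma complete_norm:
  assumes a: "a \<in> carrier R" and x: "x \<in> carrier R" and u: "u \<in> subf (t * s)" "u \<noteq> \<zero>"
  shows "\<ominus> u \<otimes> nrm x \<oplus> (a \<otimes> x \<oplus> (a \<otimes> x) [^] q)
    = \<ominus> u \<otimes> nrm (x \<oplus> \<ominus> (a [^] q \<otimes> inv u)) \<oplus> inv u \<otimes> nrm a"
proof -
  define v where "v = inv u"
  define b where "b = a [^] q \<otimes> v"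
  define a' x' where "a' = a [^] q" and "x' = x [^] q"
  have uc: "u \<in> carrier R" using u subf_carrier by blast
  have v: "v \<in> carrier R" "u \<otimes> v = \<one>" "v \<in> subf (t * s)"
    unfolding v_def using inv_nonzero[OF uc u(2)] subf_inv[OF u] by auto
  have c: "a' \<in> carrier R" "x' \<in> carrier R" "b \<in> carrier R"
    using a x v by (auto simp: a'_def x'_def b_def)
  have bq: "b [^] q = a \<otimes> v"
    using a v pow_q_q[OF a] by (simp add: b_def nat_pow_distrib subfield_pow_def)
  have ub: "u \<otimes> b = a'"
  proof -
    have "u \<otimes> b = (u \<otimes> v) \<otimes> a'"
      unfolding b_def a'_def[symmetric] using uc v(1) c by algebra
    then show ?thesis using v c by simp
  qed
  have N: "nrm (x \<oplus> \<ominus> b) = (x' \<oplus> \<ominus> (a \<otimes> v)) \<otimes> (x \<oplus> \<ominus> b)"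
    using add_pow_prime_power[of x "\<ominus> b" "t * s"] minus_pow_prime_power[OF c(3), of "t * s"] x c bq
    by (simp add: x'_def)
  \<comment> \<open>The cross terms are grouped around the products u v and u b, whose values are 1
    and a^q.\<close>
  have "\<ominus> u \<otimes> nrm (x \<oplus> \<ominus> b) = \<ominus> u \<otimes> (x' \<otimes> x) \<oplus> (u \<otimes> v) \<otimes> a \<otimes> x
      \<oplus> (u \<otimes> b) \<otimes> x' \<oplus> \<ominus> ((u \<otimes> b) \<otimes> (v \<otimes> a))"
    unfolding N using a x uc v(1) c by algebra
  also have "\<dots> = \<ominus> u \<otimes> (x' \<otimes> x) \<oplus> a \<otimes> x \<oplus> a' \<otimes> x' \<oplus> \<ominus> (a' \<otimes> (v \<otimes> a))"
    unfolding ub v(2) using a x by simp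
  finally have "\<ominus> u \<otimes> nrm (x \<oplus> \<ominus> b) \<oplus> v \<otimes> (a' \<otimes> a)
      = \<ominus> u \<otimes> (x' \<otimes> x) \<oplus> (a \<otimes> x \<oplus> a' \<otimes> x')"
    using a x uc v(1) c by algebra
  then show ?thesis
    using a x unfolding b_def v_def[symmetric] a'_def x'_def by (simp add: nat_pow_distrib)
qed

text \<open>The form is self-dual: the Fourier transform of the quadratic exponential with parameter
  -u is the one with parameter 1/u, scaled by -q. After completing the norm, translation by b
  removes a from the sum.\<close>

lemma sum_psi_r_Q_chi:
  assumes a: "a \<in> carrier R" and u: "u \<in> subf t" "u \<noteq> \<zero>"
  shows "(\<Sum>x\<in>carrier R. psi_r (\<ominus> u \<otimes> Q x) * chi (a \<otimes> x)) = - of_nat q * psi_r (inv u \<otimes> Q a)"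
proof -
  define b where "b = \<ominus> (a [^] q \<otimes> inv u)"
  have uc: "u \<in> carrier R" using u subf_carrier by blast
  have uq: "u \<in> subf (t * s)" using u subf_t_q by blast
  have mu: "\<ominus> u \<in> subf t" "\<ominus> u \<in> subf (t * s)" "\<ominus> u \<noteq> \<zero>"
    using subf_uminus u uq uc by auto
  have iu: "inv u \<in> subf t" "inv u \<in> subf (t * s)" "inv u \<in> carrier R"
    using subf_inv u uq inv_nonzero uc by auto
  have b: "b \<in> carrier R" using a iu by (simp add: b_def)
  have bij: "bij_betw (\<lambda>x. x \<oplus> b) (carrier R) (carrier R)"
    using bij_betw_add_subf[of b "2 * t * s"] b unfolding subf_M by blast
  have term_eq: "psi_r (\<ominus> u \<otimes> Q x) * chi (a \<otimes> x)
      = psi_q (\<ominus> u \<otimes> nrm (x \<oplus> b)) * psi_r (inv u \<otimes> Q a)" if x: "x \<in> carrier R" for x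
  proof -
    have ax: "a \<otimes> x \<oplus> (a \<otimes> x) [^] q \<in> subf (t * s)"
      using pow_q_q[of "a \<otimes> x"] a x
      by (simp add: subfield_pow_def add_pow_prime_power a_comm)
    have "psi_r (\<ominus> u \<otimes> Q x) * chi (a \<otimes> x)
        = psi_q (\<ominus> u \<otimes> nrm x) * psi_q (a \<otimes> x \<oplus> (a \<otimes> x) [^] q)"
      using psi_r_Q[OF mu(1) x] chi_eq_psi_q[of "a \<otimes> x"] a x by simp
    also have "\<dots> = psi_q (\<ominus> u \<otimes> nrm x \<oplus> (a \<otimes> x \<oplus> (a \<otimes> x) [^] q))"
      using add_char_add[OF subf_mult[OF mu(2) nrm_in_subf[OF x]] ax] by simp
    also have "\<dots> = psi_q (\<ominus> u \<otimes> nrm (x \<oplus> b) \<oplus> inv u \<otimes> nrm a)"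
      unfolding b_def by (subst complete_norm[OF a x uq u(2)]) (rule refl)
    also have "\<dots> = psi_q (\<ominus> u \<otimes> nrm (x \<oplus> b)) * psi_q (inv u \<otimes> nrm a)"
      using subf_mult mu iu nrm_in_subf a x b by (intro add_char_add) auto
    finally show ?thesis using psi_r_Q[OF iu(1) a] by simp
  qed
  have "(\<Sum>x\<in>carrier R. psi_r (\<ominus> u \<otimes> Q x) * chi (a \<otimes> x))
      = (\<Sum>x\<in>carrier R. psi_q (\<ominus> u \<otimes> nrm (x \<oplus> b))) * psi_r (inv u \<otimes> Q a)"
    unfolding sum_distrib_right by (rule sum.cong[OF refl term_eq])
  also have "(\<Sum>x\<in>carrier R. psi_q (\<ominus> u \<otimes> nrm (x \<oplus> b))) = (\<Sum>x\<in>carrier R. psi_q (\<ominus> u \<otimes> nrm x))"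
    by (rule sum.reindex_bij_betw[OF bij])
  also have "\<dots> = - of_nat q" by (rule sum_psi_q_nrm[OF mu(2,3)])
  finally show ?thesis .
qed


section \<open>Nonsquares\<close>

definition half_r :: nat where "half_r = (r - 1) div 2"

text \<open>The nonzero squares of F_r, encoded through Euler's criterion so that they can be
  counted as roots of unity; \<open>square_iff\<close> supplies the agreement with
  \<open>quad_char\<close>.\<close>

definition squares :: "'a set" where "squares = roots_of_unity half_r"

definition nonsquares :: "'a set" where "nonsquares = {c \<in> subf t. quad_char R r c = -1}"

lemma r_eq: "r = 2 * half_r + 1"
  using odd_p t_pos by (simp add: half_r_def)

lemma half_r_pos: "half_r > 0"
proof -
  have "r > 1" using one_less_power[of p t] p_ge_2 t_pos by simp
  then show ?thesis using r_eq by simp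
qed

lemma subf_t_minus_zero: "subf t - {\<zero>} = roots_of_unity (2 * half_r)"
  using subf_minus_zero[OF t_pos] r_eq by simp

lemma obtain_exponent: obtains m where "p ^ (2 * t * s) - 1 = 2 * half_r * m"
proof -
  have "r - 1 dvd r ^ (2 * s) - 1"
    using minus_one_dvd_power_minus_one[of r "2 * s"] p_ge_2 by simp
  moreover have "r ^ (2 * s) = p ^ (2 * t * s)" by (simp add: power_mult[symmetric] mult_ac)
  moreover have "r - 1 = 2 * half_r" using r_eq by simp
  ultimately show ?thesis using that by (metis dvd_def)
qed

text \<open>For the converse, c is a 2m-th power x^(2m) in R because it is a
  \<open>half_r\<close>-th root of unity. Its square root x^m lies in F_r since its (r - 1)-th power
  is x^(q^2 - 1) = 1.\<close>

lemma square_iff: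
  assumes c: "c \<in> subf t" "c \<noteq> \<zero>"
  shows "(\<exists>z\<in>subf t. z \<otimes> z = c) \<longleftrightarrow> c \<in> squares"
proof
  assume "\<exists>z\<in>subf t. z \<otimes> z = c"
  then obtain z where z: "z \<in> subf t" "z \<otimes> z = c" by blast
  have zc: "z \<in> carrier R" using z subf_carrier by blast
  have "z \<in> subf t - {\<zero>}" using z c zc by auto
  then have "z [^] (2 * half_r) = \<one>" unfolding subf_t_minus_zero by blast
  then have "c [^] half_r = \<one>"
    using z(2) zc by (simp add: nat_pow_distrib nat_pow_mult mult_2 flip: z(2))
  then show "c \<in> squares" using c subf_carrier by (simp add: squares_def)
next
  assume c': "c \<in> squares"
  obtain m where m: "p ^ (2 * t * s) - 1 = 2 * half_r * m" by (rule obtain_exponent)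
  have m_pos: "m > 0" using m card_gt_1 by (intro Nat.gr0I) auto
  have "p ^ (2 * t * s) - 1 = half_r * (2 * m)" using m by simp
  then have "card {x \<in> carrier R. x [^] (2 * m) = c} = 2 * m"
    using c' card_power_fibre[of half_r "2 * m" c] unfolding squares_def by blast
  then have "{x \<in> carrier R. x [^] (2 * m) = c} \<noteq> {}" using m_pos by (metis card.empty mult_is_0 not_gr_zero zero_neq_numeral)
  then obtain x where x: "x \<in> carrier R" "x [^] (2 * m) = c" by blast
  have xnz: "x \<noteq> \<zero>" using x c m_pos nat_pow_zero[of "2 * m"] by auto
  have "(x [^] m) [^] (2 * half_r) = \<one>"
    using pow_order_minus_one[OF x(1) xnz] x(1) unfolding m by (simp add: nat_pow_pow mult_ac)
  then have "x [^] m \<in> subf t" using subf_t_minus_zero x by blast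
  moreover have "x [^] m \<otimes> x [^] m = c" using x by (simp add: nat_pow_mult mult_2)
  ultimately show "\<exists>z\<in>subf t. z \<otimes> z = c" by blast
qed

lemma squares_subset: "squares \<subseteq> subf t - {\<zero>}"
proof
  fix c assume "c \<in> squares"
  then have c: "c \<in> carrier R" "c [^] half_r = \<one>" by (auto simp: squares_def)
  then have "c [^] (2 * half_r) = \<one>" by (simp add: mult_2 flip: nat_pow_mult)
  then show "c \<in> subf t - {\<zero>}" unfolding subf_t_minus_zero using c by blast
qed

lemma nonsquares_eq: "nonsquares = (subf t - {\<zero>}) - squares"
  using square_iff by (auto simp: nonsquares_def quad_char_def)

lemma nonsquares_subset: "nonsquares \<subseteq> subf t - {\<zero>}"
  by (auto simp: nonsquares_eq)

lemma finite_squares [simp]: "finite squares" and finite_nonsquares [simp]: "finite nonsquares"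
  using finite_subset[OF squares_subset] by (auto simp: nonsquares_eq)

lemma card_squares: "card squares = half_r"
proof -
  obtain m where "p ^ (2 * t * s) - 1 = 2 * half_r * m" by (rule obtain_exponent)
  then have "p ^ (2 * t * s) - 1 = half_r * (2 * m)" by simp
  then show ?thesis unfolding squares_def by (rule card_roots_of_unity)
qed

lemma card_nonsquares: "card nonsquares = half_r"
proof -
  have "card (subf t - {\<zero>}) = 2 * half_r"
    using card_Suc_Diff1[OF finite_subf subf_zero, of t] card_subf[OF t_pos t_dvd] r_eq
    by linarith
  then show ?thesis
    using card_Diff_subset[OF finite_squares squares_subset] card_squares by (simp add: nonsquares_eq)
qed

lemma minus_one_squared: "\<ominus> \<one> \<otimes> \<ominus> \<one> = \<one>"
  by (simp add: l_minus)

text \<open>For nonzero c in F_r the power c^half_r squares to 1, so it is 1 or -1, and these differ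
  because p is odd.\<close>

lemma nonsquare_iff: "c \<in> nonsquares \<longleftrightarrow> c \<in> carrier R \<and> c [^] half_r = \<ominus> \<one>"
proof -
  have one: "\<ominus> \<one> \<noteq> \<one>"
  proof
    assume "\<ominus> \<one> = \<one>"
    then have "\<one> \<oplus> \<one> = \<zero>" using r_neg[OF one_closed] by simp
    then have "[(1 + 1 :: nat)] \<cdot> \<one> = \<zero>" by simp
    then have "p dvd 1 + 1" by (simp only: add_pow_one_eq_zero_iff)
    then have "p dvd 2" by (simp only: one_add_one)
    then show False using odd_p p_ge_2 by (auto dest!: dvd_imp_le)
  qed
  have "c [^] half_r \<otimes> c [^] half_r = \<one> \<longleftrightarrow> c [^] (2 * half_r) = \<one>" if "c \<in> carrier R"
    using that by (simp add: nat_pow_mult mult_2)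
  moreover have "\<ominus> \<one> \<otimes> \<ominus> \<one> = \<one>"
    by (rule minus_one_squared)
  ultimately have "c \<in> carrier R \<and> c [^] half_r = \<ominus> \<one>
      \<longleftrightarrow> c \<in> carrier R \<and> c [^] (2 * half_r) = \<one> \<and> c [^] half_r \<noteq> \<one>"
    using square_eq_one[of "c [^] half_r"] one by (metis nat_pow_closed)
  then show ?thesis unfolding nonsquares_eq subf_t_minus_zero squares_def by blast
qed

lemma nonsquares_mult_square:
  assumes "c \<in> nonsquares" "v \<in> squares"
  shows "c \<otimes> v \<in> nonsquares"
  using assms by (auto simp: nonsquare_iff squares_def nat_pow_distrib)

text \<open>Both 1 and -1 are their own inverses, so Euler's criterion is preserved. This allows 1/u
  to be replaced by u in sums over either class.\<close>

lemma bij_betw_inv_squares: "bij_betw (\<lambda>u. inv u) squares squares"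
  and bij_betw_inv_nonsquares: "bij_betw (\<lambda>u. inv u) nonsquares nonsquares"
proof -
  have sq: "inv u \<in> squares" if "u \<in> squares" for u
    using that squares_subset inv_nonzero[of u] inv_nat_pow[of u half_r]
    by (auto simp: squares_def subset_iff)
  have "inv (\<ominus> \<one>) = \<ominus> \<one>" by (rule inv_char) (simp_all add: minus_one_squared)
  then have nsq: "inv u \<in> nonsquares" if "u \<in> nonsquares" for u
    using that nonsquares_subset inv_nonzero[of u] inv_nat_pow[of u half_r]
    by (auto simp: nonsquare_iff subset_iff)
  have ii: "inv (inv u) = u" if "u \<in> subf t - {\<zero>}" for u
    using inv_nonzero(5)[of u] subf_carrier that by blast
  show "bij_betw (\<lambda>u. inv u) squares squares"
    using sq ii squares_subset by (intro bij_betwI[where g = "\<lambda>u. inv u"]) auto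
  show "bij_betw (\<lambda>u. inv u) nonsquares nonsquares"
    using nsq ii nonsquares_subset by (intro bij_betwI[where g = "\<lambda>u. inv u"]) auto
qed

section \<open>The periods over squares and nonsquares\<close>

text \<open>The Gaussian period of index two. The alpha and beta of the overview are
  \<open>period \<one>\<close> and \<open>period g\<close> for any nonsquare g.\<close>

definition period :: "'a \<Rightarrow> complex" where "period u = (\<Sum>c\<in>nonsquares. psi_r (u \<otimes> c))"

lemma period_zero: "period \<zero> = of_nat half_r"
proof -
  have "period \<zero> = (\<Sum>c\<in>nonsquares. 1)"
    unfolding period_def using nonsquares_subset subf_carrier by (intro sum.cong) auto
  then show ?thesis by (simp add: card_nonsquares)
qed

lemma period_mult_square:
  assumes u: "u \<in> carrier R" and v: "v \<in> squares"
  shows "period (u \<otimes> v) = period u"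
proof -
  have vs: "v \<in> carrier R" "v \<noteq> \<zero>" using v squares_subset subf_carrier by auto
  have nc: "c \<in> carrier R" if "c \<in> nonsquares" for c using that by (simp add: nonsquare_iff)
  have inj: "inj_on (\<lambda>c. c \<otimes> v) nonsquares"
    using vs nc by (intro inj_onI) (simp add: m_rcancel)
  moreover have "(\<lambda>c. c \<otimes> v) ` nonsquares = nonsquares"
    using nonsquares_mult_square v by (intro endo_inj_surj inj) auto
  ultimately have bij: "bij_betw (\<lambda>c. c \<otimes> v) nonsquares nonsquares" by (simp add: bij_betw_def)
  have "period (u \<otimes> v) = (\<Sum>c\<in>nonsquares. psi_r (u \<otimes> (c \<otimes> v)))"
    unfolding period_def using u vs nc by (intro sum.cong refl arg_cong[of _ _ psi_r]) (simp add: m_ac)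
  also have "\<dots> = period u"
    unfolding period_def by (rule sum.reindex_bij_betw[OF bij])
  finally show ?thesis .
qed

lemma period_square: "u \<in> squares \<Longrightarrow> period u = period \<one>"
  using period_mult_square[of \<one> u] by (simp add: squares_def)

text \<open>The quotient of two nonsquares is a square, and scaling by squares permutes the
  nonsquares.\<close>

lemma period_nonsquare:
  assumes "u \<in> nonsquares" "v \<in> nonsquares"
  shows "period u = period v"
proof -
  have u: "u \<in> carrier R" "u \<noteq> \<zero>" "u [^] half_r = \<ominus> \<one>"
    and v: "v \<in> carrier R" "v \<noteq> \<zero>" "v [^] half_r = \<ominus> \<one>"
    using assms subsetD[OF nonsquares_subset, of u] subsetD[OF nonsquares_subset, of v]
    by (simp_all add: nonsquare_iff)
  have i: "inv v \<in> carrier R" using inv_nonzero v by blast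
  have "(inv v \<otimes> u) [^] half_r = (inv v \<otimes> v) [^] half_r"
    using u v i by (simp only: nat_pow_distrib)
  then have "inv v \<otimes> u \<in> squares"
    using u i inv_nonzero(3)[OF v(1,2)] by (simp add: squares_def)
  then have "period (v \<otimes> (inv v \<otimes> u)) = period v" using period_mult_square v by blast
  moreover have "v \<otimes> (inv v \<otimes> u) = u"
    using inv_nonzero(4)[OF v(1,2)] u v i by (simp flip: m_assoc)
  ultimately show ?thesis by simp
qed

lemma obtain_nonsquare: obtains g where "g \<in> nonsquares"
  using card_nonsquares half_r_pos by (metis card.empty equals0I less_numeral_extra(3))

lemma sum_subf_split:
  fixes F :: "'a \<Rightarrow> 'c::ab_group_add"
  shows "(\<Sum>u\<in>subf t. F u) = F \<zero> + ((\<Sum>u\<in>squares. F u) + (\<Sum>u\<in>nonsquares. F u))"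
    and "(\<Sum>u\<in>subf t - {\<zero>}. F u) = (\<Sum>u\<in>squares. F u) + (\<Sum>u\<in>nonsquares. F u)"
proof -
  show *: "(\<Sum>u\<in>subf t - {\<zero>}. F u) = (\<Sum>u\<in>squares. F u) + (\<Sum>u\<in>nonsquares. F u)"
    unfolding nonsquares_eq using sum.subset_diff[OF squares_subset, of F] by (simp add: add.commute)
  show "(\<Sum>u\<in>subf t. F u) = F \<zero> + ((\<Sum>u\<in>squares. F u) + (\<Sum>u\<in>nonsquares. F u))"
    using sum.remove[OF finite_subf subf_zero, of F t] * by simp
qed

text \<open>Summing the periods over all u in F_r gives 0, since each nonsquare c is nonzero;
  splitting F_r into its three classes gives h + h alpha + h beta, where h =
  \<open>half_r\<close>.\<close>

lemma period_sum:
  assumes g: "g \<in> nonsquares"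
  shows "period \<one> + period g = -1"
proof -
  have "(\<Sum>u\<in>subf t. period u) = (\<Sum>c\<in>nonsquares. \<Sum>u\<in>subf t. psi_r (u \<otimes> c))"
    unfolding period_def by (rule sum.swap)
  also have "\<dots> = 0"
  proof (rule sum.neutral, rule ballI)
    fix c assume "c \<in> nonsquares"
    then have "c \<in> subf t" "c \<noteq> \<zero>" using nonsquares_subset by auto
    then show "(\<Sum>u\<in>subf t. psi_r (u \<otimes> c)) = 0" using sum_add_char[OF t_pos t_dvd] by simp
  qed
  finally have "of_nat half_r + ((\<Sum>u\<in>squares. period u) + (\<Sum>u\<in>nonsquares. period u)) = 0"
    unfolding sum_subf_split(1)[of period] period_zero .
  moreover have "(\<Sum>u\<in>squares. period u) = of_nat half_r * period \<one>"
    using period_square card_squares by simp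
  moreover have "(\<Sum>u\<in>nonsquares. period u) = of_nat half_r * period g"
    using period_nonsquare[OF _ g] card_nonsquares by simp
  ultimately have "of_nat half_r * (1 + (period \<one> + period g)) = 0" by (simp add: distrib_left)
  then show ?thesis using half_r_pos by (simp add: add_eq_0_iff)
qed

text \<open>Parseval for the nonsquares reads h^2 + h (|alpha|^2 + |beta|^2) = r h with h =
  \<open>half_r\<close>, and r - h = h + 1.\<close>

lemma period_norm_sum:
  assumes g: "g \<in> nonsquares"
  shows "(cmod (period \<one>))\<^sup>2 + (cmod (period g))\<^sup>2 = real half_r + 1"
proof -
  have "(\<Sum>u\<in>subf t. (cmod (period u))\<^sup>2) = real (r * half_r)"
    unfolding period_def using sum_norm_char_sum[OF t_pos t_dvd, of nonsquares] nonsquares_subset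
    by (auto simp: card_nonsquares)
  then have "(cmod (period \<zero>))\<^sup>2 + ((\<Sum>u\<in>squares. (cmod (period u))\<^sup>2) + (\<Sum>u\<in>nonsquares. (cmod (period u))\<^sup>2)) = real (r * half_r)"
    unfolding sum_subf_split(1) .
  moreover have "(\<Sum>u\<in>squares. (cmod (period u))\<^sup>2) = real half_r * (cmod (period \<one>))\<^sup>2"
    using period_square card_squares by simp
  moreover have "(\<Sum>u\<in>nonsquares. (cmod (period u))\<^sup>2) = real half_r * (cmod (period g))\<^sup>2"
    using period_nonsquare[OF _ g] card_nonsquares by simp
  moreover have "real (r * half_r) = real half_r * (2 * real half_r + 1)"
    using r_eq by (simp add: algebra_simps)
  ultimately have "real half_r * ((cmod (period \<one>))\<^sup>2 + (cmod (period g))\<^sup>2) = real half_r * (real half_r + 1)"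
    by (simp add: period_zero power2_eq_square algebra_simps)
  then show ?thesis using half_r_pos by simp
qed

text \<open>What the character sum over D leaves behind once the inner sums over R are evaluated; it
  sees a only through c = Q(a).\<close>

definition dual_sum :: "'a \<Rightarrow> complex" where
  "dual_sum c = (\<Sum>u\<in>subf t - {\<zero>}. period u * psi_r (inv u \<otimes> c))"

lemma dual_sum_zero: "dual_sum \<zero> = - of_nat half_r"
proof -
  obtain g where g: "g \<in> nonsquares" by (rule obtain_nonsquare)
  have "dual_sum \<zero> = (\<Sum>u\<in>subf t - {\<zero>}. period u)"
    unfolding dual_sum_def using inv_nonzero subf_carrier by (intro sum.cong) auto
  also have "\<dots> = of_nat half_r * period \<one> + of_nat half_r * period g"
    unfolding sum_subf_split(2) using period_square period_nonsquare[OF _ g] card_squares card_nonsquares by simp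
  also have "\<dots> = of_nat half_r * (period \<one> + period g)" by (simp add: distrib_left)
  finally show ?thesis by (simp add: period_sum[OF g])
qed

text \<open>For c <> 0 the sum is 2 alpha beta or alpha^2 + beta^2, according to the class of c.
  Either is bounded by |alpha|^2 + |beta|^2, the first by the inequality between arithmetic and
  geometric mean.\<close>

lemma norm_dual_sum_le:
  assumes c: "c \<in> subf t"
  shows "cmod (dual_sum c) \<le> real half_r + 1"
proof (cases "c = \<zero>")
  case True
  then show ?thesis by (simp add: dual_sum_zero)
next
  case False
  obtain g where g: "g \<in> nonsquares" by (rule obtain_nonsquare)
  have cc: "c \<in> carrier R" using c subf_carrier by blast
  have comm: "psi_r (u \<otimes> c) = psi_r (c \<otimes> u)" if "u \<in> subf t" for u
    using that cc subf_carrier by (simp add: m_comm)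
  have nsq: "(\<Sum>u\<in>nonsquares. psi_r (inv u \<otimes> c)) = period c"
  proof -
    have "(\<Sum>u\<in>nonsquares. psi_r (inv u \<otimes> c)) = (\<Sum>u\<in>nonsquares. psi_r (u \<otimes> c))"
      by (rule sum.reindex_bij_betw[OF bij_betw_inv_nonsquares])
    then show ?thesis unfolding period_def using comm nonsquares_subset by (auto intro!: sum.cong)
  qed
  \<comment> \<open>The character sums to 0 over F_r, so the squares contribute -1 -
    \<open>period c\<close>. Writing -1 as alpha + beta makes the final expression homogeneous of
    degree two.\<close>
  have sq: "(\<Sum>u\<in>squares. psi_r (inv u \<otimes> c)) = period \<one> + period g - period c"
  proof -
    have "(\<Sum>u\<in>squares. psi_r (inv u \<otimes> c)) = (\<Sum>u\<in>squares. psi_r (u \<otimes> c))"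
      by (rule sum.reindex_bij_betw[OF bij_betw_inv_squares])
    moreover have "(\<Sum>u\<in>nonsquares. psi_r (u \<otimes> c)) = period c"
      unfolding period_def using comm nonsquares_subset by (auto intro!: sum.cong)
    moreover have "(\<Sum>u\<in>subf t. psi_r (u \<otimes> c)) = 0"
      using sum_add_char[OF t_pos t_dvd c] False by simp
    moreover have "psi_r (\<zero> \<otimes> c) = 1" using cc by simp
    ultimately show ?thesis
      unfolding period_sum[OF g] sum_subf_split(1)[of "\<lambda>u. psi_r (u \<otimes> c)"]
      by (simp add: algebra_simps eq_neg_iff_add_eq_0)
  qed
  have dual_sum: "dual_sum c = period \<one> * (period \<one> + period g - period c) + period g * period c"
  proof -
    have "dual_sum c = (\<Sum>u\<in>squares. period \<one> * psi_r (inv u \<otimes> c)) + (\<Sum>u\<in>nonsquares. period g * psi_r (inv u \<otimes> c))"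
      unfolding dual_sum_def sum_subf_split(2) using period_square period_nonsquare[OF _ g] by simp
    then show ?thesis by (simp add: sum_distrib_left[symmetric] sq nsq)
  qed
  show ?thesis
  proof (cases "c \<in> squares")
    case True
    then have "dual_sum c = 2 * (period \<one> * period g)" unfolding dual_sum by (simp add: period_square algebra_simps)
    then have "cmod (dual_sum c) = 2 * cmod (period \<one>) * cmod (period g)" by (simp add: norm_mult)
    also have "\<dots> \<le> (cmod (period \<one>))\<^sup>2 + (cmod (period g))\<^sup>2"
      by (rule sum_squares_bound)
    finally show ?thesis by (simp add: period_norm_sum[OF g])
  next
    case nsq: False
    then have "c \<in> nonsquares" using c False by (simp add: nonsquares_eq)
    then have "period c = period g" using period_nonsquare g by blast
    then have "dual_sum c = (period \<one>)\<^sup>2 + (period g)\<^sup>2" unfolding dual_sum by (simp add: power2_eq_square)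
    then have "cmod (dual_sum c) \<le> (cmod (period \<one>))\<^sup>2 + (cmod (period g))\<^sup>2"
      by (metis norm_power norm_triangle_ineq)
    then show ?thesis by (simp add: period_norm_sum[OF g])
  qed
qed


section \<open>The correlation of the codebook\<close>

abbreviation D :: "'a set" where "D \<equiv> defset R p t s"
abbreviation K :: nat where "K \<equiv> card D"

definition char_sum :: "'a \<Rightarrow> complex" where "char_sum a = (\<Sum>x\<in>D. chi (a \<otimes> x))"

lemma D_eq: "D = {x \<in> carrier R. Q x \<in> nonsquares}"
  using Q_in_subf by (auto simp: defset_def nonsquares_def power_mult)

lemma finite_D [simp]: "finite D" using fin by (simp add: D_eq)

lemma D_subset: "D \<subseteq> carrier R" by (auto simp: D_eq)

lemma Q_zero: "Q \<zero> = \<zero>"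
proof -
  have "\<zero> [^] (r ^ i) = \<zero>" for i
    using zero_pow_prime_power[of "t * i"] by (simp only: power_mult)
  then have "rel_trace R r i \<zero> = \<zero>" for i
    by (induction i) (simp_all add: rel_trace_Suc)
  then show ?thesis by simp
qed

text \<open>The condition Q(x) = c is detected by averaging psi_r(u (c - Q(x))) over u in F_r, and
  summing over the nonsquares c produces \<open>period u\<close>. The term u = 0 is a full character
  sum over R, hence the case split on a; every other u falls under
  \<open>sum_psi_r_Q_chi\<close>.\<close>

lemma char_sum_formula:
  assumes a: "a \<in> carrier R"
  shows "of_nat r * char_sum a = (if a = \<zero> then of_nat (half_r * q\<^sup>2) else 0) - of_nat q * dual_sum (Q a)"
proof -
  let ?W = "\<lambda>u. \<Sum>x\<in>carrier R. psi_r (\<ominus> u \<otimes> Q x) * chi (a \<otimes> x)"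
  have sum_u: "(\<Sum>u\<in>subf t. psi_r (u \<otimes> c) * psi_r (\<ominus> u \<otimes> Q x)) = (if Q x = c then of_nat r else 0)"
    if c: "c \<in> subf t" and x: "x \<in> carrier R" for c x
  proof -
    note Qx = Q_in_subf[OF x]
    have cc: "c \<in> carrier R" "Q x \<in> carrier R" using c Qx subf_carrier by auto
    have d: "c \<oplus> \<ominus> Q x \<in> subf t" using c Qx subf_add subf_uminus by blast
    have "psi_r (u \<otimes> c) * psi_r (\<ominus> u \<otimes> Q x) = psi_r (u \<otimes> (c \<oplus> \<ominus> Q x))" if u: "u \<in> subf t" for u
    proof -
      have "u \<otimes> (c \<oplus> \<ominus> Q x) = u \<otimes> c \<oplus> \<ominus> u \<otimes> Q x"
        using cc subf_carrier[OF u] by algebra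
      then show ?thesis
        using u c Qx by (simp add: add_char_add subf_mult subf_uminus)
    qed
    moreover have "c \<oplus> \<ominus> Q x = \<zero> \<longleftrightarrow> Q x = c"
      using cc r_right_minus_eq[of c "Q x"] by (auto simp: a_minus_def)
    ultimately show ?thesis using sum_add_char[OF t_pos t_dvd d] by simp
  qed
  have "(\<Sum>u\<in>subf t. period u * ?W u)
      = (\<Sum>u\<in>subf t. \<Sum>c\<in>nonsquares. \<Sum>x\<in>carrier R.
          psi_r (u \<otimes> c) * psi_r (\<ominus> u \<otimes> Q x) * chi (a \<otimes> x))"
    unfolding period_def by (simp add: sum_product mult.assoc)
  also have "\<dots> = (\<Sum>c\<in>nonsquares. \<Sum>x\<in>carrier R. \<Sum>u\<in>subf t.
          psi_r (u \<otimes> c) * psi_r (\<ominus> u \<otimes> Q x) * chi (a \<otimes> x))"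
    by (subst sum.swap, rule sum.cong[OF refl], rule sum.swap)
  also have "\<dots> = (\<Sum>c\<in>nonsquares. \<Sum>x\<in>carrier R. (if Q x = c then of_nat r * chi (a \<otimes> x) else 0))"
  proof (intro sum.cong refl)
    fix c x assume "c \<in> nonsquares" "x \<in> carrier R"
    then show "(\<Sum>u\<in>subf t. psi_r (u \<otimes> c) * psi_r (\<ominus> u \<otimes> Q x) * chi (a \<otimes> x))
        = (if Q x = c then of_nat r * chi (a \<otimes> x) else 0)"
      using sum_u[of c x] nonsquares_subset by (auto simp: sum_distrib_right[symmetric])
  qed
  also have "\<dots> = (\<Sum>x\<in>carrier R. \<Sum>c\<in>nonsquares. (if Q x = c then of_nat r * chi (a \<otimes> x) else 0))"
    by (rule sum.swap)
  also have "\<dots> = (\<Sum>x\<in>carrier R. if Q x \<in> nonsquares then of_nat r * chi (a \<otimes> x) else 0)"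
    by (intro sum.cong refl) (simp add: sum.delta')
  also have "\<dots> = (\<Sum>x\<in>D. of_nat r * chi (a \<otimes> x))"
    unfolding D_eq by (rule sum.inter_filter[OF fin, symmetric])
  also have "\<dots> = of_nat r * char_sum a" by (simp add: char_sum_def sum_distrib_left)
  finally have "of_nat r * char_sum a = (\<Sum>u\<in>subf t. period u * ?W u)" ..
  also have "\<dots> = period \<zero> * ?W \<zero> + (\<Sum>u\<in>subf t - {\<zero>}. period u * ?W u)"
    by (rule sum.remove[OF finite_subf subf_zero])
  also have "(\<Sum>u\<in>subf t - {\<zero>}. period u * ?W u) = - of_nat q * dual_sum (Q a)"
  proof -
    have "(\<Sum>u\<in>subf t - {\<zero>}. period u * ?W u)
        = (\<Sum>u\<in>subf t - {\<zero>}. - of_nat q * (period u * psi_r (inv u \<otimes> Q a)))"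
    proof (rule sum.cong[OF refl])
      fix u assume "u \<in> subf t - {\<zero>}"
      then have "?W u = - of_nat q * psi_r (inv u \<otimes> Q a)"
        using sum_psi_r_Q_chi[OF a] by blast
      then show "period u * ?W u = - of_nat q * (period u * psi_r (inv u \<otimes> Q a))"
        by (simp only: mult_ac)
    qed
    then show ?thesis by (simp only: dual_sum_def sum_distrib_left)
  qed
  also have "?W \<zero> = (\<Sum>x\<in>subf (2 * t * s). chi (x \<otimes> a))"
    unfolding subf_M
  proof (intro sum.cong refl)
    fix x assume x: "x \<in> carrier R"
    then have "\<ominus> \<zero> \<otimes> Q x = \<zero>" by simp
    then show "psi_r (\<ominus> \<zero> \<otimes> Q x) * chi (a \<otimes> x) = chi (x \<otimes> a)"
      using x a by (simp only: add_char_zero m_comm) simp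
  qed
  also have "\<dots> = (if a = \<zero> then of_nat (q\<^sup>2) else 0)"
    using sum_add_char[OF M_gt_0 dvd_refl, of a] a subf_M by (simp add: q_sq[symmetric] power2_eq_square)
  finally show ?thesis by (simp add: period_zero)
qed

text \<open>The formula at a = 0, where the dual sum is -h: q^2 h + q h, with h =
  \<open>half_r\<close>.\<close>

lemma card_D: "r * K = q * (q + 1) * half_r"
proof -
  have "char_sum \<zero> = of_nat K"
    unfolding char_sum_def using D_subset by (simp add: subset_iff)
  then have "(of_nat (r * K) :: complex) = of_nat (q * (q + 1) * half_r)"
    using char_sum_formula[of \<zero>] unfolding Q_zero dual_sum_zero by (simp add: power2_eq_square algebra_simps)
  then show ?thesis by (simp only: of_nat_eq_iff)
qed

lemma card_D_real: "real r * real K = real q * (real q + 1) * real half_r"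
  using arg_cong[OF card_D, of real] by (simp only: of_nat_mult of_nat_add of_nat_1)

lemma norm_char_sum_le:
  assumes "a \<in> carrier R" "a \<noteq> \<zero>"
  shows "real r * cmod (char_sum a) \<le> real q * (real half_r + 1)"
proof -
  have "of_nat r * char_sum a = - of_nat q * dual_sum (Q a)" using char_sum_formula assms by simp
  then have "real r * cmod (char_sum a) = real q * cmod (dual_sum (Q a))"
    by (metis norm_minus_cancel norm_mult norm_of_nat)
  then show ?thesis using norm_dual_sum_le[OF Q_in_subf[OF assms(1)]] by (simp add: mult_left_mono)
qed

lemma sum_norm_char_sum_sq: "(\<Sum>a\<in>carrier R. (cmod (char_sum a))\<^sup>2) = real (q\<^sup>2 * K)"
  unfolding char_sum_def using sum_norm_char_sum[OF M_gt_0 dvd_refl, of D] D_subset subf_M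
  by (simp add: q_sq[symmetric] power2_eq_square)

lemma codebook_corr_eq:
  assumes "a \<in> carrier R" "a' \<in> carrier R"
  shows "codebook_corr R p t s a a' = char_sum (a \<ominus> a') / of_nat K"
proof -
  have "chi (a \<otimes> x) / of_real (sqrt (real K)) * cnj (chi (a' \<otimes> x) / of_real (sqrt (real K)))
      = chi ((a \<ominus> a') \<otimes> x) / of_nat K" if x: "x \<in> carrier R" for x
  proof -
    have "(a \<ominus> a') \<otimes> x = a \<otimes> x \<oplus> \<ominus> (a' \<otimes> x)" using assms x by algebra
    then have "chi ((a \<ominus> a') \<otimes> x) = chi (a \<otimes> x) * cnj (chi (a' \<otimes> x))"
      using assms x add_char_add[of "a \<otimes> x" "2 * t * s" "\<ominus> (a' \<otimes> x)"]
        add_char_uminus[of "a' \<otimes> x" "2 * t * s"] unfolding subf_M by simp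
    moreover have "complex_of_real (sqrt (real K)) * of_real (sqrt (real K)) = of_nat K"
      by (simp flip: of_real_mult)
    ultimately show ?thesis by simp
  qed
  then show ?thesis
    unfolding codebook_corr_def Let_def char_sum_def sum_divide_distrib using D_subset
    by (intro sum.cong refl) auto
qed

text \<open>A correlation depends only on the difference a - a', and every nonzero a arises as a -
  0.\<close>

lemma Imax_eq: "Imax R p t s = Max ((\<lambda>a. cmod (char_sum a) / real K) ` (carrier R - {\<zero>}))"
proof -
  have "{cmod (codebook_corr R p t s a a') | a a'. a \<in> carrier R \<and> a' \<in> carrier R \<and> a \<noteq> a'}
      = (\<lambda>a. cmod (char_sum a) / real K) ` (carrier R - {\<zero>})" (is "?A = ?B")
  proof (intro equalityI subsetI)
    fix y assume "y \<in> ?A"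
    then obtain a a' where a: "a \<in> carrier R" "a' \<in> carrier R" "a \<noteq> a'"
      and y: "y = cmod (codebook_corr R p t s a a')" by blast
    have "a \<ominus> a' \<in> carrier R - {\<zero>}" using a by simp
    moreover have "y = cmod (char_sum (a \<ominus> a')) / real K"
      unfolding y codebook_corr_eq[OF a(1,2)] by (simp add: norm_divide)
    ultimately show "y \<in> ?B" by blast
  next
    fix y assume "y \<in> ?B"
    then obtain a where a: "a \<in> carrier R" "a \<noteq> \<zero>" and y: "y = cmod (char_sum a) / real K" by blast
    have "a \<ominus> \<zero> = a" using a by (simp add: a_minus_def)
    then have "y = cmod (codebook_corr R p t s a \<zero>)"
      unfolding y codebook_corr_eq[OF a(1) zero_closed] by (simp add: norm_divide)
    then show "y \<in> ?A" using a by blast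
  qed
  then show ?thesis by (simp add: Imax_def)
qed

section \<open>Comparison of the maximal correlation with the Welch bound\<close>

lemma q_ge: "q \<ge> 2"
proof -
  have "q > 1" using one_less_power[of p "t * s"] p_ge_2 ts_pos by simp
  then show ?thesis by simp
qed

lemma real_q_ge: "real q \<ge> 2"
  using of_nat_mono[OF q_ge, where 'a = real] by simp

lemma real_r: "real r = 2 * real half_r + 1"
  using arg_cong[OF r_eq, of real] by simp

lemma K_pos: "K > 0"
proof (rule Nat.gr0I)
  assume "K = 0"
  then have "q * (q + 1) * half_r = 0" using card_D by (simp only: mult_0_right)
  then show False using q_ge half_r_pos by (simp only: mult_eq_0_iff) linarith
qed

text \<open>With \<^term>\<open>r = 2 * half_r + 1\<close> one finds
  \<open>(N - K) / K = (q (half_r + 1) - half_r) / ((q + 1) half_r)\<close> for \<open>N = q^2\<close>.\<close>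

lemma welch_bound_sq:
  "(welch_bound (q\<^sup>2) K)\<^sup>2
    = (real q * (real half_r + 1) - real half_r) / ((real q - 1) * (real q + 1)\<^sup>2 * real half_r)"
  "welch_bound (q\<^sup>2) K > 0"
  "real (q\<^sup>2) - real K = (real (q\<^sup>2) - 1) * real K * (welch_bound (q\<^sup>2) K)\<^sup>2"
proof -
  let ?q = "real q" and ?half_r = "real half_r" and ?r = "real r"
  have q2: "?q \<ge> 2" by (rule real_q_ge)
  have hp: "?half_r > 0" using half_r_pos by simp
  have re: "?r = 2 * ?half_r + 1" by (rule real_r)
  have r0: "?r > 0" using re hp by simp
  have Ke: "real K = ?q * (?q + 1) * ?half_r / ?r"
    unfolding card_D_real[symmetric] using r0 by (intro nonzero_mult_div_cancel_left[symmetric]) linarith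
  have NK: "real (q\<^sup>2) - real K = ?q * (?q * (?half_r + 1) - ?half_r) / ?r"
  proof -
    have "(real (q\<^sup>2) - real K) * ?r = ?q * (?q * (?half_r + 1) - ?half_r)"
    proof -
      have "(real (q\<^sup>2) - real K) * ?r = ?q\<^sup>2 * ?r - ?r * real K"
        by (simp add: algebra_simps)
      also have "\<dots> = ?q\<^sup>2 * (2 * ?half_r + 1) - ?q * (?q + 1) * ?half_r"
        by (simp only: card_D_real) (simp only: re)
      also have "\<dots> = ?q * (?q * (?half_r + 1) - ?half_r)"
        by (simp add: power2_eq_square algebra_simps)
      finally show ?thesis .
    qed
    then show ?thesis using r0 by (simp add: eq_divide_eq)
  qed
  have pos: "?q * (?half_r + 1) - ?half_r > 0"
  proof -
    have "?q * (?half_r + 1) \<ge> 2 * (?half_r + 1)" using q2 hp by (intro mult_right_mono) auto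
    moreover have "?half_r < 2 * (?half_r + 1)" using hp by (simp add: distrib_left)
    ultimately show ?thesis by (simp only: diff_gt_0_iff_gt less_le_trans)
  qed
  have K0: "real K > 0" using K_pos by simp
  have N1: "real (q\<^sup>2) - 1 = (?q - 1) * (?q + 1)" by (simp add: power2_eq_square algebra_simps)
  have N1p: "real (q\<^sup>2) - 1 > 0" unfolding N1 using q2 by simp
  have NKp: "real (q\<^sup>2) - real K > 0"
    unfolding NK using q2
    by (intro divide_pos_pos mult_pos_pos pos r0) (rule less_le_trans[OF zero_less_numeral])
  have sq: "(welch_bound (q\<^sup>2) K)\<^sup>2 = (real (q\<^sup>2) - real K) / ((real (q\<^sup>2) - 1) * real K)"
    unfolding welch_bound_def using NKp N1p K0
    by (intro real_sqrt_pow2) (simp only: less_imp_le divide_nonneg_pos mult_pos_pos)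
  show "welch_bound (q\<^sup>2) K > 0"
    unfolding welch_bound_def using NKp N1p K0 by (simp only: real_sqrt_gt_0_iff divide_pos_pos mult_pos_pos)
  show "real (q\<^sup>2) - real K = (real (q\<^sup>2) - 1) * real K * (welch_bound (q\<^sup>2) K)\<^sup>2"
    unfolding sq times_divide_eq_right
    using mult_pos_pos[OF N1p K0] by (intro nonzero_mult_div_cancel_left[symmetric]) linarith
  \<comment> \<open>The shape of (N - K)/((N - 1) K) with x = q, w = \<open>half_r\<close>, z = r
    and y = q (half_r + 1) - half_r.\<close>
  have cancel: "(x * y / z) / ((x - 1) * (x + 1) * (x * (x + 1) * w / z)) = y / ((x - 1) * (x + 1)\<^sup>2 * w)"
    if "x \<ge> 2" "w > 0" "z > 0" for w x y z :: real
    using that by (simp add: power2_eq_square divide_simps)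
  show "(welch_bound (q\<^sup>2) K)\<^sup>2 = (?q * (?half_r + 1) - ?half_r) / ((?q - 1) * (?q + 1)\<^sup>2 * ?half_r)"
    unfolding sq unfolding NK unfolding N1 Ke using q2 hp r0 by (rule cancel)
qed

text \<open>The maximum dominates the mean square. Parseval gives N K in total, the term a = 0 takes
  K^2 of it, and the remaining K (N - K) is spread over N - 1 values of a.\<close>

lemma Imax_ge_welch_bound: "Imax R p t s \<ge> welch_bound (q\<^sup>2) K"
proof -
  let ?I = "Imax R p t s" and ?N = "real (q\<^sup>2)"
  have K0: "real K > 0" using K_pos by simp
  have N1: "?N > 1" using real_q_ge less_1_mult[of "real q" "real q"] by (simp add: power2_eq_square)
  have ne: "carrier R - {\<zero>} \<noteq> {}" using one_closed one_not_zero by blast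
  have le: "cmod (char_sum a) / real K \<le> ?I" if "a \<in> carrier R - {\<zero>}" for a
    unfolding Imax_eq using that fin by (intro Max_ge) auto
  have I0: "?I \<ge> 0" using le[of \<one>] one_closed one_not_zero by (meson DiffI divide_nonneg_nonneg norm_ge_zero of_nat_0_le_iff order_trans singletonD)
  have "char_sum \<zero> = of_nat K"
    unfolding char_sum_def using D_subset by (simp add: subset_iff)
  then have "?N * real K - (real K)\<^sup>2 = (\<Sum>a\<in>carrier R - {\<zero>}. (cmod (char_sum a))\<^sup>2)"
    using sum_norm_char_sum_sq sum.remove[OF fin zero_closed, of "\<lambda>a. (cmod (char_sum a))\<^sup>2"] by simp
  also have "\<dots> \<le> (\<Sum>a\<in>carrier R - {\<zero>}. (?I * real K)\<^sup>2)"
  proof (intro sum_mono power_mono)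
    fix a assume "a \<in> carrier R - {\<zero>}"
    then show "cmod (char_sum a) \<le> ?I * real K" using le[of a] K0 by (simp add: divide_le_eq)
  qed simp
  also have "\<dots> = (?N - 1) * (?I * real K)\<^sup>2"
  proof -
    have "card (carrier R - {\<zero>}) = q\<^sup>2 - 1"
      using card_R fin q_sq by (simp add: power2_eq_square)
    moreover have "1 \<le> q\<^sup>2" using q_ge by simp
    ultimately have "real (card (carrier R - {\<zero>})) = ?N - 1" by (simp only: of_nat_diff of_nat_1)
    then show ?thesis by simp
  qed
  finally have "real K * (?N - real K) \<le> real K * ((?N - 1) * real K * ?I\<^sup>2)"
    by (simp add: power2_eq_square algebra_simps)
  then have "?N - real K \<le> (?N - 1) * real K * ?I\<^sup>2" using K0 by simp
  then have "(?N - 1) * real K * (welch_bound (q\<^sup>2) K)\<^sup>2 \<le> (?N - 1) * real K * ?I\<^sup>2"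
    using welch_bound_sq(3) by simp
  then have "(welch_bound (q\<^sup>2) K)\<^sup>2 \<le> ?I\<^sup>2" using K0 N1 by simp
  then show ?thesis using I0 by (rule power2_le_imp_le)
qed

lemma Imax_le: "Imax R p t s \<le> (real half_r + 1) / ((real q + 1) * real half_r)"
proof -
  have q0: "real q > 0" and r0: "real r > 0" and K0: "real K > 0"
    using real_q_ge real_r K_pos by linarith+
  have "cmod (char_sum a) / real K \<le> (real half_r + 1) / ((real q + 1) * real half_r)"
    if a: "a \<in> carrier R - {\<zero>}" for a
  proof -
    have "cmod (char_sum a) / real K = real r * cmod (char_sum a) / (real r * real K)"
      by (rule mult_divide_mult_cancel_left[symmetric]) (use r0 in linarith)
    also have "\<dots> \<le> real q * (real half_r + 1) / (real r * real K)"
      using norm_char_sum_le[of a] a r0 K0 by (intro divide_right_mono) auto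
    also note card_D_real
    also have "real q * (real half_r + 1) / (real q * (real q + 1) * real half_r) = (real half_r + 1) / ((real q + 1) * real half_r)"
      unfolding mult.assoc by (rule mult_divide_mult_cancel_left) (use q0 in linarith)
    finally show ?thesis .
  qed
  moreover have "carrier R - {\<zero>} \<noteq> {}" using one_closed one_not_zero by blast
  ultimately show ?thesis unfolding Imax_eq using fin by (subst Max_le_iff) auto
qed

text \<open>Writing h for \<open>half_r\<close>, the upper bound on \<open>Imax\<close> is (1 +
  1/h)/(q + 1), so it suffices that 1/(q + 1) is at most the Welch bound; and 1/h = 2/(r -
  1).\<close>

lemma ratio_bounds:
  "1 \<le> Imax R p t s / welch_bound (q\<^sup>2) K"
  "Imax R p t s / welch_bound (q\<^sup>2) K \<le> 1 + 2 / (real r - 1)"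
proof -
  let ?I = "Imax R p t s" and ?W = "welch_bound (q\<^sup>2) K" and ?q = "real q" and ?half_r = "real half_r"
  have W: "?W > 0" by (rule welch_bound_sq(2))
  show "1 \<le> ?I / ?W" using Imax_ge_welch_bound W by simp
  have q2: "?q \<ge> 2" and hp: "?half_r > 0" using real_q_ge half_r_pos by simp_all
  have I0: "?I \<ge> 0" using Imax_ge_welch_bound W by linarith
  \<comment> \<open>The two sides differ by exactly 1. Lowering \<open>half_r + 1\<close> to
    \<open>half_r\<close> on the left then makes the quotient collapse to 1/(q + 1)^2.\<close>
  have key: "(?q - 1) * (?half_r + 1) \<le> ?q * (?half_r + 1) - ?half_r" by (simp add: algebra_simps)
  have "?I\<^sup>2 \<le> ((?half_r + 1) / ((?q + 1) * ?half_r))\<^sup>2"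
    using Imax_le I0 by (rule power_mono)
  also have "\<dots> \<le> (1 + 1 / ?half_r)\<^sup>2 * ?W\<^sup>2"
  proof -
    have "(?half_r + 1) / ((?q + 1) * ?half_r) = (1 + 1 / ?half_r) / (?q + 1)"
      using hp q2 by (simp add: field_simps)
    then have "((?half_r + 1) / ((?q + 1) * ?half_r))\<^sup>2 = (1 + 1 / ?half_r)\<^sup>2 * (1 / (?q + 1)\<^sup>2)"
      by (simp only: power_divide times_divide_eq_right mult_1_right)
    moreover have "1 / (?q + 1)\<^sup>2 \<le> ?W\<^sup>2"
    proof -
      have "(?q - 1) * ?half_r \<le> (?q - 1) * (?half_r + 1)" using q2 by (intro mult_left_mono) auto
      then have "(?q - 1) * ?half_r \<le> ?q * (?half_r + 1) - ?half_r" using key by linarith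
      then have "(?q - 1) * ?half_r / ((?q - 1) * (?q + 1)\<^sup>2 * ?half_r) \<le> ?W\<^sup>2"
        unfolding welch_bound_sq(1) using q2 hp by (intro divide_right_mono) auto
      moreover have "(?q - 1) * ?half_r / ((?q - 1) * (?q + 1)\<^sup>2 * ?half_r) = 1 / (?q + 1)\<^sup>2"
        using q2 hp by simp
      ultimately show ?thesis by simp
    qed
    ultimately show ?thesis by (simp only: mult_left_mono zero_le_power2)
  qed
  finally have "?I\<^sup>2 \<le> ((1 + 1 / ?half_r) * ?W)\<^sup>2" by (simp only: power_mult_distrib)
  moreover have "0 \<le> (1 + 1 / ?half_r) * ?W"
    using W hp by (intro mult_nonneg_nonneg add_nonneg_nonneg divide_nonneg_nonneg) linarith+
  ultimately have "?I \<le> (1 + 1 / ?half_r) * ?W" by (rule power2_le_imp_le)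
  moreover have "2 / (real r - 1) = 1 / ?half_r" unfolding real_r by simp
  ultimately show "?I / ?W \<le> 1 + 2 / (real r - 1)"
    by (simp only: pos_divide_le_eq[OF W])
qed

end

text \<open>The ratio lies between 1 and 1 + 2/(r - 1), uniformly in s, so r tending to infinity
  alone squeezes it to 1.\<close>

theorem mainTheorem8:
  fixes p t s :: "nat \<Rightarrow> nat" and F :: "nat \<Rightarrow> ('a, 'm) ring_scheme"
  assumes "\<And>n. Factorial_Ring.prime (p n) \<and> odd (p n)"
    and "\<And>n. t n > 0 \<and> s n > 0"
    and "\<And>n. field (F n) \<and> finite (carrier (F n))
               \<and> card (carrier (F n)) = ((p n ^ t n) ^ s n) ^ 2"
    and "filterlim (\<lambda>n. p n ^ t n) at_top sequentially"
  shows "(\<lambda>n. Imax (F n) (p n) (t n) (s n)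
              / welch_bound (((p n ^ t n) ^ s n) ^ 2) (card (defset (F n) (p n) (t n) (s n))))
         \<longlonglongrightarrow> 1"
proof -
  have form: "trace_norm_form (F n) (p n) (t n) (s n)" for n
  proof -
    have "((p n ^ t n) ^ s n) ^ 2 = p n ^ (2 * t n * s n)"
      by (simp add: power_mult[symmetric] mult_ac)
    then show ?thesis
      using assms(1)[of n] assms(2)[of n] assms(3)[of n]
      by (intro trace_norm_form.intro finite_field_order.intro finite_field_order_axioms.intro
          trace_norm_form_axioms.intro) auto
  qed
  let ?g = "\<lambda>n. Imax (F n) (p n) (t n) (s n)
      / welch_bound (((p n ^ t n) ^ s n) ^ 2) (card (defset (F n) (p n) (t n) (s n)))"
  have lower: "1 \<le> ?g n" for n
    using trace_norm_form.ratio_bounds(1)[OF form[of n]] by (simp only: power_mult)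
  have upper: "?g n \<le> 1 + 2 / (real (p n ^ t n) - 1)" for n
    using trace_norm_form.ratio_bounds(2)[OF form[of n]] by (simp only: power_mult)
  have "filterlim (\<lambda>n. real (p n ^ t n)) at_top sequentially"
    using assms(4) filterlim_compose[OF filterlim_real_sequentially] by blast
  moreover have "((\<lambda>x::real. 1 + 2 / (x - 1)) \<longlongrightarrow> 1) at_top"
    by real_asymp
  ultimately have lim: "(\<lambda>n. 1 + 2 / (real (p n ^ t n) - 1)) \<longlonglongrightarrow> 1"
    by (rule filterlim_compose[rotated])
  show ?thesis
    by (rule tendsto_sandwich[OF _ _ tendsto_const lim])
      (rule always_eventually, rule allI, fact lower upper)+
qed

end
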